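(* Let $S\subseteq\mathbb{R}^n$ be a convex set which is SDP representable. Then the following hold. (a) The interior of $S$ is a finite union of basic open semialgebraic sets, i.e. $\overset{\circ}{S}=\bigcup_{k=1}^m T_k$ with $T_k=\{x\in\mathbb{R}^n: g^k_1(x)>0,\dots,g^k_{m_k}(x)>0\}$ for some polynomials $g^k_i$. (b) The closure of $S$ is a finite union of basic closed semialgebraic sets, i.e. $\overline{S}=\bigcup_{k=1}^m T_k$ with $T_k=\{x\in\mathbb{R}^n: g^k_1(x)\ge 0,\dots,g^k_{m_k}(x)\ge 0\}$ for some polynomials $g^k_i$ (possibly different from those in (a)). (c) For any sets $T_k$ and polynomials $g^k_i$ as in (b), any $k$, any $u\in\partial\overline{S}\cap\partial T_k$ and any $i\in I_k(u)$: if $g^k_i$ is irredundant at $u$ with respect to $\partial\overline{S}$ and nonsingular at $u$, then $g^k_i$ is quasi-concave at $u$.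
   Context: A set $S\subseteq\mathbb{R}^n$ is SDP representable if there are $N\ge 0$ and real symmetric matrices $A_0,A_1,\dots,A_n,B_1,\dots,B_N$ of a common size such that $S=\{x\in\mathbb{R}^n:\exists u\in\mathbb{R}^N,\ A_0+\sum_{i=1}^n x_iA_i+\sum_{j=1}^N u_jB_j\succeq 0\}$, where $\succeq 0$ means positive semidefinite. $\partial$ denotes topological boundary. For $T_k=\{x: g^k_1(x)\ge 0,\dots,g^k_{m_k}(x)\ge 0\}$ and $u\in\partial T_k$, let $I_k(u)=\{1\le i\le m_k: g^k_i(u)=0\}$ be the active set. The point $u$ is a nonsingular point on $\partial T_k$ if $|I_k(u)|=1$ and $\nabla g^k_i(u)\ne 0$ for $i\in I_k(u)$. The polynomial $g^k_i$ is irredundant at $u$ with respect to $\partial\overline S$ if there is a sequence of nonsingular points $u_N$ on $\partial T_k$ with $u_N\in\{x:g^k_i(x)=0\}\cap\partial\overline S$ and $u_N\to u$. It is nonsingular at $u$ if $\nabla g^k_i(u)\ne 0$. A smooth function $f$ is quasi-concave at $u$ if $-v^T\nabla^2 f(u)v\ge 0$ for all $v\in\mathbb{R}^n$ with $\nabla f(u)^Tv=0$. *)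

theory Defs
  imports "HOL-Analysis.Analysis"
begin

(* Real d x d matrices are functions nat => nat => real of which only the entries with
   indices below d matter: in the definition of SDP representability the size d is
   existentially quantified, so it cannot be a type. *)

definition symmetric_matrix :: "nat \<Rightarrow> (nat \<Rightarrow> nat \<Rightarrow> real) \<Rightarrow> bool" where
  "symmetric_matrix d M \<longleftrightarrow> (\<forall>r<d. \<forall>c<d. M r c = M c r)"

definition positive_semidefinite :: "nat \<Rightarrow> (nat \<Rightarrow> nat \<Rightarrow> real) \<Rightarrow> bool" where
  "positive_semidefinite d M \<longleftrightarrow>
     symmetric_matrix d M \<and> (\<forall>v::nat \<Rightarrow> real. 0 \<le> (\<Sum>r<d. \<Sum>c<d. v r * M r c * v c))"

definition SDP_representable :: "(real ^ 'n) set \<Rightarrow> bool" where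
  "SDP_representable S \<longleftrightarrow>
     (\<exists>(d::nat) (N::nat) A0 (A :: 'n \<Rightarrow> nat \<Rightarrow> nat \<Rightarrow> real) (B :: nat \<Rightarrow> nat \<Rightarrow> nat \<Rightarrow> real).
        symmetric_matrix d A0 \<and> (\<forall>i. symmetric_matrix d (A i)) \<and>
        (\<forall>j<N. symmetric_matrix d (B j)) \<and>
        S = {x. \<exists>u::nat \<Rightarrow> real.
               positive_semidefinite d
                 (\<lambda>r c. A0 r c + (\<Sum>i\<in>UNIV. x $ i * A i r c) + (\<Sum>j<N. u j * B j r c))})"

(* A finite system g_1, ..., g_m of polynomials is a list; its indices run from 0 to m - 1.
   Polynomials in n real variables are the functions satisfying real_polynomial_function. *)

definition basic_open_set :: "(real ^ 'n \<Rightarrow> real) list \<Rightarrow> (real ^ 'n) set" where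
  "basic_open_set gs = {x. \<forall>i<length gs. (gs ! i) x > 0}"

definition basic_closed_set :: "(real ^ 'n \<Rightarrow> real) list \<Rightarrow> (real ^ 'n) set" where
  "basic_closed_set gs = {x. \<forall>i<length gs. (gs ! i) x \<ge> 0}"

definition partial_deriv :: "'n \<Rightarrow> (real ^ 'n \<Rightarrow> real) \<Rightarrow> real ^ 'n \<Rightarrow> real" where
  "partial_deriv i f x = deriv (\<lambda>t. f (x + t *\<^sub>R axis i 1)) 0"

definition gradient :: "(real ^ 'n \<Rightarrow> real) \<Rightarrow> real ^ 'n \<Rightarrow> real ^ 'n" where
  "gradient f x = (\<chi> i. partial_deriv i f x)"

definition hessian :: "(real ^ 'n \<Rightarrow> real) \<Rightarrow> real ^ 'n \<Rightarrow> real ^ 'n ^ 'n" where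
  "hessian f x = (\<chi> i j. partial_deriv i (partial_deriv j f) x)"

(* Meaningful for smooth f only, since deriv is unspecified at points of
   non-differentiability; it is applied to polynomials. *)
definition quasi_concave_at :: "(real ^ 'n \<Rightarrow> real) \<Rightarrow> real ^ 'n \<Rightarrow> bool" where
  "quasi_concave_at f u \<longleftrightarrow>
     (\<forall>v. gradient f u \<bullet> v = 0 \<longrightarrow> - (v \<bullet> (hessian f u *v v)) \<ge> 0)"

definition active_indices :: "(real ^ 'n \<Rightarrow> real) list \<Rightarrow> real ^ 'n \<Rightarrow> nat set" where
  "active_indices gs u = {i. i < length gs \<and> (gs ! i) u = 0}"

definition nonsingular_at :: "(real ^ 'n \<Rightarrow> real) \<Rightarrow> real ^ 'n \<Rightarrow> bool" where
  "nonsingular_at f u \<longleftrightarrow> gradient f u \<noteq> 0"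

definition nonsingular_boundary_point :: "(real ^ 'n \<Rightarrow> real) list \<Rightarrow> real ^ 'n \<Rightarrow> bool" where
  "nonsingular_boundary_point gs u \<longleftrightarrow>
     u \<in> frontier (basic_closed_set gs) \<and> card (active_indices gs u) = 1 \<and>
     (\<forall>i\<in>active_indices gs u. gradient (gs ! i) u \<noteq> 0)"

(* The set argument is the boundary with respect to which irredundancy is meant. *)
definition irredundant_at ::
    "(real ^ 'n \<Rightarrow> real) list \<Rightarrow> nat \<Rightarrow> (real ^ 'n) set \<Rightarrow> real ^ 'n \<Rightarrow> bool" where
  "irredundant_at gs i bd u \<longleftrightarrow>
     (\<exists>w :: nat \<Rightarrow> real ^ 'n.
        (\<forall>N. nonsingular_boundary_point gs (w N) \<and> w N \<in> {x. (gs ! i) x = 0} \<inter> bd) \<and>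
        w \<longlonglongrightarrow> u)"

end

theory Submission
  imports Defs "HOL-Computational_Algebra.Polynomial" "HOL-Library.Multiset"
begin

text \<open>
  By Tarski--Seidenberg the sets \<open>S\<close>, \<open>closure S\<close> and \<open>interior S\<close> are semialgebraic.
  Quantifier elimination follows Hoermander: the sign pattern along the real line of finitely many
  univariate polynomials is determined, up to an increasing bijection of the line, by the pattern
  of a simpler family in which a polynomial of maximal degree is replaced by its derivative and by
  its remainders modulo the others.

  An open semialgebraic \<open>U\<close> is a finite union of sign classes \<open>{f = 0, g\<^sub>1 > 0, \<dots>, g\<^sub>m > 0}\<close>
  with \<open>f \<ge> 0\<close>.  Writing \<open>g\<close> for the product of the \<open>g\<^sub>i\<close>, a Lojasiewicz inequality on the
  part of the complement of \<open>U\<close> where all \<open>g\<^sub>i \<ge> 0\<close> allows \<open>f = 0\<close> to be relaxed to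
  \<open>f * ((R + |x|\<^sup>2) * g + 1)^M < g^M\<close> without leaving \<open>U\<close>.  Complements give the closed case.

  For quasi-concavity, a direction \<open>v\<close> tangent to \<open>g\<^sub>i = 0\<close> at a nonsingular boundary point \<open>w\<close> with
  \<open>v \<bullet> (H v) > 0\<close> would put the parabolas \<open>w \<plusminus> t v + s t\<^sup>2 \<nabla>g\<^sub>i(w)\<close> with suitable \<open>s < 0\<close>
  into the set, on the wrong side of a supporting hyperplane.  The general case is a limit of this one.
\<close>

section \<open>Matching the signs of functions on the line\<close>

lemma strict_mono_bump:
  fixes a b c e :: real
  assumes "a < c" "c < b" "a < e" "e < b"
  shows "\<exists>\<theta>::real \<Rightarrow> real. strict_mono \<theta> \<and> surj \<theta> \<and> \<theta> c = e \<and> (\<forall>x. x \<le> a \<or> b \<le> x \<longrightarrow> \<theta> x = x)"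
proof -
  \<comment> \<open>The map is affine on each side of \<open>c\<close> inside the interval.
    Exchanging \<open>c\<close> and \<open>e\<close> inverts it, which gives surjectivity.\<close>
  define h where "h c e x = (if x \<le> a \<or> b \<le> x then x
      else if x \<le> c then a + (x - a) * ((e - a) / (c - a))
      else b - (b - x) * ((b - e) / (b - c)))" for c e x :: real
  have lo: "a < a + (x - a) * ((e - a) / (c - a)) \<and> a + (x - a) * ((e - a) / (c - a)) \<le> e"
    if "a < c" "a < e" "a < x" "x \<le> c" for c e x
  proof -
    have "(x - a) * ((e - a) / (c - a)) \<le> (c - a) * ((e - a) / (c - a))"
      using that by (intro mult_right_mono) auto
    then show ?thesis using that by auto
  qed
  have hi: "e < b - (b - x) * ((b - e) / (b - c)) \<and> b - (b - x) * ((b - e) / (b - c)) < b"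
    if "c < b" "e < b" "x < b" "c < x" for c e x
  proof -
    have "(b - x) * ((b - e) / (b - c)) < (b - c) * ((b - e) / (b - c))"
      using that by (intro mult_strict_right_mono) auto
    then show ?thesis using that by auto
  qed
  have mono: "h c e x < h c e y" if ce: "a < c" "c < b" "a < e" "e < b" and "x < y" for c e x y
  proof -
    have L: "(x - a) * ((e - a) / (c - a)) < (y - a) * ((e - a) / (c - a))"
      using ce \<open>x < y\<close> by (intro mult_strict_right_mono) auto
    have R: "(b - y) * ((b - e) / (b - c)) < (b - x) * ((b - e) / (b - c))"
      using ce \<open>x < y\<close> by (intro mult_strict_right_mono) auto
    show ?thesis
      using L R lo[of c e x] hi[of c e x] lo[of c e y] hi[of c e y] ce \<open>x < y\<close>
      unfolding h_def by (smt (verit))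
  qed
  have inv: "h c e (h e c x) = x" if ce: "a < c" "c < b" "a < e" "e < b" for c e x
  proof (cases "x \<le> a \<or> b \<le> x")
    case False
    show ?thesis
    proof (cases "x \<le> e")
      case True
      then show ?thesis using lo[of e c x] ce False by (simp add: h_def not_le divide_le_0_iff mult_le_0_iff)
    next
      case F: False
      then show ?thesis using hi[of e c x] ce False by (simp add: h_def not_le divide_le_0_iff mult_le_0_iff)
    qed
  qed (simp add: h_def)
  show ?thesis
  proof (intro exI[of _ "h c e"] conjI)
    show "strict_mono (h c e)" using mono assms by (simp add: strict_mono_def)
    show "surj (h c e)" using inv assms by (metis surjI)
    show "h c e c = e" using assms by (simp add: h_def)
  qed (simp add: h_def)
qed

text \<open>If the sign changes strictly between the end points, each function has exactly one zero
  inside, and a bump moves one zero to the other. Otherwise the signs at the ends and the common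
  direction of monotonicity force the sign inside, and the identity works.\<close>

lemma sign_match_interval:
  fixes P Q :: "real \<Rightarrow> real"
  assumes ab: "a < b" and cont: "continuous_on UNIV P" "continuous_on UNIV Q"
    and mono: "\<And>x y. a \<le> x \<Longrightarrow> x < y \<Longrightarrow> y \<le> b \<Longrightarrow> sgn (P y - P x) = \<sigma> \<and> sgn (Q y - Q x) = \<sigma>"
    and \<sigma>: "\<sigma> \<noteq> (0::real)"
    and ends: "sgn (P a) = sgn (Q a)" "sgn (P b) = sgn (Q b)"
  shows "\<exists>\<theta>::real \<Rightarrow> real. strict_mono \<theta> \<and> surj \<theta> \<and> (\<forall>x. x \<le> a \<or> b \<le> x \<longrightarrow> \<theta> x = x) \<and>
    (\<forall>x\<in>{a..b}. sgn (P x) = sgn (Q (\<theta> x)))"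
proof -
  have s1: "\<sigma> = 1 \<or> \<sigma> = -1" using mono[of a b] ab \<sigma> by (metis order_refl sgn_real_def)
  show ?thesis
  proof (cases "P a * P b < 0")
    case True
    have "Q a * Q b < 0" using True ends by (metis sgn_mult sgn_less)
    have root: "\<exists>x. a < x \<and> x < b \<and> f x = 0"
      if "continuous_on UNIV f" "f a * f b < 0" for f :: "real \<Rightarrow> real"
    proof -
      have c: "continuous_on {a..b} f" using that(1) continuous_on_subset by blast
      have "\<exists>x\<ge>a. x \<le> b \<and> f x = 0"
      proof (cases "f a < 0")
        case True
        then have "f b > 0" using that(2) by (simp add: mult_less_0_iff)
        then show ?thesis using IVT'[of f a 0 b] c ab True by auto
      next
        case False
        then have "f b < 0" "f a > 0" using that(2) by (auto simp: mult_less_0_iff)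
        then show ?thesis using IVT2'[of f b 0 a] c ab by auto
      qed
      then show ?thesis using that(2) by (metis less_eq_real_def mult_zero_left mult_zero_right less_irrefl)
    qed
    obtain c where c: "a < c" "c < b" "P c = 0" using root[OF cont(1) True] by auto
    obtain e where e: "a < e" "e < b" "Q e = 0" using root[OF cont(2) \<open>Q a * Q b < 0\<close>] by auto
    obtain \<theta> where \<theta>: "strict_mono \<theta>" "surj \<theta>" "\<theta> c = e" "\<And>x. x \<le> a \<or> b \<le> x \<Longrightarrow> \<theta> x = x"
      using strict_mono_bump[OF c(1,2) e(1,2)] by auto
    have "sgn (P x) = sgn (Q (\<theta> x))" if x: "x \<in> {a..b}" for x
    proof -
      have tx: "a \<le> \<theta> x" "\<theta> x \<le> b"
        using x \<theta>(4)[of a] \<theta>(4)[of b] strict_mono_less_eq[OF \<theta>(1)] by (metis atLeastAtMost_iff order_refl)+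
      consider "x < c" | "x = c" | "c < x" by linarith
      then show ?thesis
      proof cases
        case 1
        then have "\<theta> x < e" using \<theta>(1,3) by (metis strict_mono_less)
        then show ?thesis using mono[of x c] mono[of "\<theta> x" e] x 1 tx c e by (auto simp: sgn_minus)
      next
        case 3
        then have "e < \<theta> x" using \<theta>(1,3) by (metis strict_mono_less)
        then show ?thesis using mono[of c x] mono[of e "\<theta> x"] x 3 tx c e by auto
      qed (use c e \<theta> in auto)
    qed
    then show ?thesis using \<theta> by blast
  next
    case False
    have "sgn (P x) = sgn (Q x)" if x: "x \<in> {a..b}" for x
    proof (cases "x = a \<or> x = b")
      case F: False
      have "sgn (P x - P a) = \<sigma>" "sgn (Q x - Q a) = \<sigma>" "sgn (P b - P x) = \<sigma>" "sgn (Q b - Q x) = \<sigma>"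
        using mono[of a x] mono[of x b] x F by auto
      then show ?thesis using s1 ends False
        by (auto simp: sgn_real_def mult_less_0_iff not_less split: if_splits)
    qed (use ends in auto)
    then show ?thesis by (intro exI[of _ id]) (auto simp: strict_mono_def)
  qed
qed

text \<open>Consecutive intervals of the list are matched one at a time. Each matching is the
  identity off its own interval, so composing them spoils nothing.\<close>

lemma sign_match_list:
  fixes P Q :: "real \<Rightarrow> real"
  assumes cont: "continuous_on UNIV P" "continuous_on UNIV Q"
    and "sorted_wrt (<) (a # zs)"
    and "\<And>u v. a \<le> u \<Longrightarrow> u < v \<Longrightarrow> v \<le> last (a # zs) \<Longrightarrow> {u<..<v} \<inter> set (a # zs) = {} \<Longrightarrow>
      \<exists>\<sigma>. \<sigma> \<noteq> 0 \<and> (\<forall>x y. u \<le> x \<longrightarrow> x < y \<longrightarrow> y \<le> v \<longrightarrow> sgn (P y - P x) = \<sigma> \<and> sgn (Q y - Q x) = \<sigma>)"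
    and "\<And>z. z \<in> set (a # zs) \<Longrightarrow> sgn (P z) = sgn (Q z)"
  shows "\<exists>\<theta>::real \<Rightarrow> real. strict_mono \<theta> \<and> surj \<theta> \<and>
    (\<forall>x. x \<le> a \<or> last (a # zs) \<le> x \<or> x \<in> set zs \<longrightarrow> \<theta> x = x) \<and>
    (\<forall>x\<in>{a..last (a # zs)}. sgn (P x) = sgn (Q (\<theta> x)))"
  using assms(3-)
proof (induction zs arbitrary: a)
  case Nil
  then show ?case by (intro exI[of _ id]) (auto simp: strict_mono_def)
next
  case (Cons b zs)
  have ab: "a < b" and srt: "sorted_wrt (<) (b # zs)" and gt: "\<And>z. z \<in> set zs \<Longrightarrow> b < z"
    using Cons.prems(1) by auto
  have bl: "b \<le> last (b # zs)" using gt by (cases zs rule: rev_cases) (auto simp: less_imp_le)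
  have l: "last (a # b # zs) = last (b # zs)" by simp
  have "\<exists>\<theta>::real \<Rightarrow> real. strict_mono \<theta> \<and> surj \<theta> \<and>
    (\<forall>x. x \<le> b \<or> last (b # zs) \<le> x \<or> x \<in> set zs \<longrightarrow> \<theta> x = x) \<and>
    (\<forall>x\<in>{b..last (b # zs)}. sgn (P x) = sgn (Q (\<theta> x)))"
  proof (rule Cons.IH[OF srt])
    fix u v assume "b \<le> u" "u < v" "v \<le> last (b # zs)" "{u<..<v} \<inter> set (b # zs) = {}"
    then show "\<exists>\<sigma>. \<sigma> \<noteq> 0 \<and> (\<forall>x y. u \<le> x \<longrightarrow> x < y \<longrightarrow> y \<le> v \<longrightarrow> sgn (P y - P x) = \<sigma> \<and> sgn (Q y - Q x) = \<sigma>)"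
      using Cons.prems(2)[of u v] ab l by auto
  qed (use Cons.prems(3) in auto)
  then obtain \<theta>2 :: "real \<Rightarrow> real" where \<theta>2: "strict_mono \<theta>2" "surj \<theta>2"
    "\<And>x. x \<le> b \<or> last (b # zs) \<le> x \<or> x \<in> set zs \<Longrightarrow> \<theta>2 x = x"
    "\<And>x. x \<in> {b..last (b # zs)} \<Longrightarrow> sgn (P x) = sgn (Q (\<theta>2 x))" by blast
  have "{a<..<b} \<inter> set (a # b # zs) = {}" using gt by force
  then obtain \<sigma> where \<sigma>: "\<sigma> \<noteq> 0"
    "\<And>x y. a \<le> x \<Longrightarrow> x < y \<Longrightarrow> y \<le> b \<Longrightarrow> sgn (P y - P x) = \<sigma> \<and> sgn (Q y - Q x) = \<sigma>"
    using Cons.prems(2)[of a b] ab bl l by auto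
  have "sgn (P a) = sgn (Q a)" "sgn (P b) = sgn (Q b)"
    using Cons.prems(3) by auto
  from sign_match_interval[OF ab cont \<sigma>(2) \<sigma>(1) this]
  obtain \<theta>1 :: "real \<Rightarrow> real" where \<theta>1: "strict_mono \<theta>1" "surj \<theta>1"
    "\<And>x. x \<le> a \<or> b \<le> x \<Longrightarrow> \<theta>1 x = x"
    "\<And>x. x \<in> {a..b} \<Longrightarrow> sgn (P x) = sgn (Q (\<theta>1 x))" by blast
  have le: "\<theta>1 x \<le> b" if "x \<le> b" for x
    using \<theta>1(3)[of b] strict_mono_less_eq[OF \<theta>1(1), of x b] that by auto
  have ge: "b \<le> \<theta>2 x" if "b \<le> x" for x
    using \<theta>2(3)[of b] strict_mono_less_eq[OF \<theta>2(1), of b x] that by auto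
  show ?case
  proof (intro exI[of _ "\<theta>1 \<circ> \<theta>2"] conjI ballI allI impI)
    show "strict_mono (\<theta>1 \<circ> \<theta>2)" using \<theta>1(1) \<theta>2(1) by (simp add: strict_mono_def)
    show "surj (\<theta>1 \<circ> \<theta>2)" using \<theta>1(2) \<theta>2(2) comp_surj by blast
  next
    fix x assume "x \<le> a \<or> last (a # b # zs) \<le> x \<or> x \<in> set (b # zs)"
    then have "x \<le> a \<or> (b \<le> x \<and> (last (b # zs) \<le> x \<or> x \<in> set (b # zs)))"
      using bl l gt by force
    then show "(\<theta>1 \<circ> \<theta>2) x = x"
      using \<theta>2(3)[of x] \<theta>1(3)[of x] ab by auto
  next
    fix x assume "x \<in> {a..last (a # b # zs)}"
    then show "sgn (P x) = sgn (Q ((\<theta>1 \<circ> \<theta>2) x))"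
      using \<theta>1(4)[of x] \<theta>2(3)[of x] \<theta>2(4)[of x] \<theta>1(3)[of "\<theta>2 x"] ge[of x] l
      by (cases "x \<le> b") auto
  qed
qed

text \<open>Far out the signs already agree point by point, so only a bounded interval, cut at the
  points of \<open>Z\<close>, has to be matched. Keeping \<open>Z\<close> fixed matters later, when
  these points are the roots of polynomials that are already matched.\<close>

lemma sign_match_global:
  fixes P Q :: "real \<Rightarrow> real"
  assumes cont: "continuous_on UNIV P" "continuous_on UNIV Q"
    and fin: "finite Z"
    and mono: "\<And>u v. u < v \<Longrightarrow> {u<..<v} \<inter> Z = {} \<Longrightarrow>
      \<exists>\<sigma>. \<sigma> \<noteq> 0 \<and> (\<forall>x y. u \<le> x \<longrightarrow> x < y \<longrightarrow> y \<le> v \<longrightarrow> sgn (P y - P x) = \<sigma> \<and> sgn (Q y - Q x) = \<sigma>)"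
    and Z: "\<And>z. z \<in> Z \<Longrightarrow> sgn (P z) = sgn (Q z)"
    and inf: "\<And>x. M \<le> \<bar>x\<bar> \<Longrightarrow> sgn (P x) = sgn (Q x)"
  shows "\<exists>\<theta>::real \<Rightarrow> real. strict_mono \<theta> \<and> surj \<theta> \<and> (\<forall>z\<in>Z. \<theta> z = z) \<and>
    (\<forall>x. sgn (P x) = sgn (Q (\<theta> x)))"
proof -
  have "finite (insert \<bar>M\<bar> (abs ` Z))" using fin by simp
  then obtain b where b: "\<bar>M\<bar> < b" "\<And>z. z \<in> Z \<Longrightarrow> \<bar>z\<bar> < b"
    using Max_ge[of "insert \<bar>M\<bar> (abs ` Z)"]
    by (metis image_eqI insertCI less_add_one order_le_less_trans)
  define zs where "zs = sorted_list_of_set Z @ [b]"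
  have set: "set zs = insert b Z" using fin by (simp add: zs_def)
  have srt: "sorted_wrt (<) (- b # zs)"
    using b fin by (force simp: zs_def sorted_wrt_append)
  have l: "last (- b # zs) = b" by (simp add: zs_def)
  have "\<exists>\<theta>::real \<Rightarrow> real. strict_mono \<theta> \<and> surj \<theta> \<and>
    (\<forall>x. x \<le> - b \<or> last (- b # zs) \<le> x \<or> x \<in> set zs \<longrightarrow> \<theta> x = x) \<and>
    (\<forall>x\<in>{- b..last (- b # zs)}. sgn (P x) = sgn (Q (\<theta> x)))"
  proof (rule sign_match_list[OF cont srt])
    fix u v assume "u < v" "{u<..<v} \<inter> set (- b # zs) = {}"
    then show "\<exists>\<sigma>. \<sigma> \<noteq> 0 \<and> (\<forall>x y. u \<le> x \<longrightarrow> x < y \<longrightarrow> y \<le> v \<longrightarrow> sgn (P y - P x) = \<sigma> \<and> sgn (Q y - Q x) = \<sigma>)"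
      by (intro mono) (auto simp: set)
  next
    fix z assume "z \<in> set (- b # zs)"
    then have "z \<in> Z \<or> M \<le> \<bar>z\<bar>" using b(1) set by auto
    then show "sgn (P z) = sgn (Q z)" using Z inf by blast
  qed
  then obtain \<theta> :: "real \<Rightarrow> real" where \<theta>: "strict_mono \<theta>" "surj \<theta>"
    "\<And>x. x \<le> - b \<or> b \<le> x \<or> x \<in> set zs \<Longrightarrow> \<theta> x = x"
    "\<And>x. x \<in> {- b..b} \<Longrightarrow> sgn (P x) = sgn (Q (\<theta> x))" unfolding l by blast
  have "sgn (P x) = sgn (Q (\<theta> x))" for x
    using \<theta>(3)[of x] \<theta>(4)[of x] inf[of x] b(1) by (cases "x \<in> {- b..b}") auto
  then show ?thesis using \<theta> set by blast
qed

section \<open>Signs of univariate polynomials and extension of a sign matching\<close>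

lemma poly_sgn_at_top:
  fixes p :: "real poly"
  shows "\<exists>M. \<forall>x\<ge>M. sgn (poly p x) = sgn (lead_coeff p)"
proof -
  have pos: "\<exists>M. \<forall>x\<ge>M. poly q x > 0" if "lead_coeff q > 0" for q :: "real poly"
    using poly_pinfty_gt_lc[OF that] that by (meson order_less_le_trans)
  consider "lead_coeff p > 0" | "lead_coeff p = 0" | "lead_coeff (- p) > 0"
    by fastforce
  then show ?thesis
  proof cases
    case 3
    then obtain M where "\<forall>x\<ge>M. poly (- p) x > 0" using pos by blast
    then have "\<forall>x\<ge>M. sgn (poly p x) = -1" by simp
    then show ?thesis using 3 by auto
  qed (use pos[of p] in \<open>auto simp: sgn_real_def\<close>)
qed

text \<open>The arguments \<open>x\<close> and \<open>y\<close> vary independently because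
  \<open>P\<close> at a point will be compared with \<open>Q\<close> at the image of that point.
  Minus infinity is reached through \<open>p(-x)\<close>, whose leading coefficient depends on the
  parity of the degree.\<close>

lemma poly_sgn_at_infinity:
  fixes p q :: "real poly"
  assumes "degree p = degree q" "sgn (lead_coeff p) = sgn (lead_coeff q)"
  shows "\<exists>M. \<forall>x y. (M \<le> x \<and> M \<le> y) \<or> (x \<le> - M \<and> y \<le> - M) \<longrightarrow> sgn (poly p x) = sgn (poly q y)"
proof -
  let ?n = "\<lambda>p::real poly. p \<circ>\<^sub>p [:0, -1:]"
  have lc: "sgn (lead_coeff (?n p)) = sgn (lead_coeff (?n q))"
    using assms by (simp add: lead_coeff_comp sgn_mult)
  obtain A B C D where
    "\<forall>x\<ge>A. sgn (poly p x) = sgn (lead_coeff p)" "\<forall>x\<ge>B. sgn (poly q x) = sgn (lead_coeff q)"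
    "\<forall>x\<ge>C. sgn (poly (?n p) x) = sgn (lead_coeff (?n p))"
    "\<forall>x\<ge>D. sgn (poly (?n q) x) = sgn (lead_coeff (?n q))"
    using poly_sgn_at_top by metis
  note M = this[unfolded poly_pcompose]
  show ?thesis
  proof (intro exI[of _ "max (max A B) (max C D)"] allI impI)
    fix x y
    assume "max (max A B) (max C D) \<le> x \<and> max (max A B) (max C D) \<le> y \<or>
      x \<le> - max (max A B) (max C D) \<and> y \<le> - max (max A B) (max C D)"
    then show "sgn (poly p x) = sgn (poly q y)"
    proof
      assume "x \<le> - max (max A B) (max C D) \<and> y \<le> - max (max A B) (max C D)"
      then have "C \<le> - x" "D \<le> - y" by auto
      then show ?thesis using M(3)[rule_format, of "- x"] M(4)[rule_format, of "- y"] lc by simp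
    qed (use M(1,2) assms(2) in auto)
  qed
qed

lemma strict_mono_surj_continuous:
  fixes \<phi> :: "real \<Rightarrow> real"
  assumes "strict_mono \<phi>" "surj \<phi>"
  shows "continuous_on UNIV \<phi>"
  using assms by (intro continuous_onI_mono) (auto simp: strict_mono_less_eq)

text \<open>A strictly increasing map that fixes every root cannot carry a point across a root,
  whereas a change of sign would put a root strictly between \<open>t\<close> and its image.\<close>

lemma sgn_poly_fixing_roots:
  fixes q :: "real poly"
  assumes "strict_mono \<psi>" "\<And>z. poly q z = 0 \<Longrightarrow> \<psi> z = z"
  shows "sgn (poly q t) = sgn (poly q (\<psi> t))"
proof (rule ccontr)
  assume ne: "sgn (poly q t) \<noteq> sgn (poly q (\<psi> t))"
  then have 1: "poly q t \<noteq> 0" using assms(2) by auto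
  have 2: "poly q (\<psi> t) \<noteq> 0"
    using assms ne by (metis strict_mono_eq)
  have "poly q t * poly q (\<psi> t) < 0"
    using ne 1 2 by (auto simp: sgn_real_def mult_less_0_iff split: if_splits)
  moreover have "t \<noteq> \<psi> t" using ne by auto
  ultimately obtain z where "(t < z \<and> z < \<psi> t) \<or> (\<psi> t < z \<and> z < t)" "poly q z = 0"
    using poly_IVT[of t "\<psi> t" q] poly_IVT[of "\<psi> t" t q] by (metis linorder_neqE mult.commute)
  then show False using assms by (metis less_asym strict_mono_less)
qed

text \<open>Between neighbouring roots of the nonzero \<open>p\<close> in \<open>E\<close> the
  derivative of \<open>P\<close> has no zero, so \<open>P\<close> is strictly monotone there; since
  \<open>\<phi>\<close> matches the derivatives, \<open>Q\<close> after \<open>\<phi>\<close> is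
  monotone in the same direction. Signs agree at the roots by \<open>roots\<close> and near infinity
  by the leading coefficients, so \<open>sign_match_global\<close> supplies a correction
  \<open>\<theta>\<close>. It fixes the roots and therefore preserves the matching of
  \<open>E\<close>.\<close>

lemma sign_match_extend:
  fixes P Q :: "real poly" and E :: "(real poly \<times> real poly) set"
  assumes \<phi>: "strict_mono \<phi>" "surj \<phi>" and fin: "finite E"
    and sg: "\<And>p q t. (p, q) \<in> E \<Longrightarrow> sgn (poly p t) = sgn (poly q (\<phi> t))"
    and der: "(pderiv P, pderiv Q) \<in> E"
    and deg: "degree P = degree Q" "degree P \<noteq> 0" "sgn (lead_coeff P) = sgn (lead_coeff Q)"
    and roots: "\<And>p q z. (p, q) \<in> E \<Longrightarrow> p \<noteq> 0 \<Longrightarrow> poly p z = 0 \<Longrightarrow> sgn (poly P z) = sgn (poly Q (\<phi> z))"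
  shows "\<exists>\<psi>. strict_mono \<psi> \<and> surj \<psi> \<and>
    (\<forall>(p, q)\<in>insert (P, Q) E. \<forall>t. sgn (poly p t) = sgn (poly q (\<psi> t)))"
proof -
  define Z where "Z = (\<Union>(p, q)\<in>{e \<in> E. fst e \<noteq> 0}. {z. poly p z = 0})"
  have finZ: "finite Z" unfolding Z_def using fin by (auto intro!: poly_roots_finite)
  have ZI: "z \<in> Z" if "(p, q) \<in> E" "p \<noteq> 0" "poly p z = 0" for p q z
    using that unfolding Z_def by force
  have P'0: "pderiv P \<noteq> 0" using deg(2) by (simp add: pderiv_eq_0_iff)
  have mono: "\<exists>\<sigma>. \<sigma> \<noteq> 0 \<and> (\<forall>x y. u \<le> x \<longrightarrow> x < y \<longrightarrow> y \<le> v \<longrightarrow>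
      sgn (poly P y - poly P x) = \<sigma> \<and> sgn (poly Q (\<phi> y) - poly Q (\<phi> x)) = \<sigma>)"
    if uv: "u < v" "{u<..<v} \<inter> Z = {}" for u v
  proof -
    let ?m = "(u + v) / 2"
    have nz: "poly (pderiv P) x \<noteq> 0" if "u < x" "x < v" for x
      using ZI[OF der P'0, of x] uv that by auto
    have const: "sgn (poly (pderiv P) x) = sgn (poly (pderiv P) ?m)" if x: "u < x" "x < v" for x
    proof (rule ccontr)
      assume ne: "\<not> ?thesis"
      then have "x \<noteq> ?m" by metis
      have "poly (pderiv P) x * poly (pderiv P) ?m < 0"
        using ne nz[OF x] nz[of ?m] uv(1) by (auto simp: sgn_real_def mult_less_0_iff split: if_splits)
      with \<open>x \<noteq> ?m\<close> obtain z where "(x < z \<and> z < ?m) \<or> (?m < z \<and> z < x)" "poly (pderiv P) z = 0"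
        using poly_IVT[of x ?m "pderiv P"] poly_IVT[of ?m x "pderiv P"]
        by (metis linorder_neqE mult.commute)
      then show False using nz[of z] x uv(1) by auto
    qed
    show ?thesis
    proof (intro exI[of _ "sgn (poly (pderiv P) ?m)"] conjI allI impI)
      show "sgn (poly (pderiv P) ?m) \<noteq> 0" using nz[of ?m] uv(1) by (simp add: sgn_zero_iff)
    next
      fix x y assume xy: "u \<le> x" "x < y" "y \<le> v"
      obtain \<xi> where "x < \<xi>" "\<xi> < y" "poly P y - poly P x = (y - x) * poly (pderiv P) \<xi>"
        using poly_MVT[OF xy(2), of P] by auto
      then show "sgn (poly P y - poly P x) = sgn (poly (pderiv P) ?m)"
        using const[of \<xi>] xy by (simp add: sgn_mult)
      have "\<phi> x < \<phi> y" using \<phi>(1) xy(2) by (simp add: strict_mono_less)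
      then obtain \<eta> where \<eta>: "\<phi> x < \<eta>" "\<eta> < \<phi> y"
        "poly Q (\<phi> y) - poly Q (\<phi> x) = (\<phi> y - \<phi> x) * poly (pderiv Q) \<eta>"
        using poly_MVT[of "\<phi> x" "\<phi> y" Q] by auto
      obtain \<xi>' where "\<eta> = \<phi> \<xi>'" using \<phi>(2) by (metis surjD)
      then show "sgn (poly Q (\<phi> y) - poly Q (\<phi> x)) = sgn (poly (pderiv P) ?m)"
        using \<eta> const[of \<xi>'] xy sg[OF der, of \<xi>'] \<phi>(1) by (simp add: sgn_mult strict_mono_less)
    qed
  qed
  obtain M where M: "\<And>x y. (M \<le> x \<and> M \<le> y) \<or> (x \<le> - M \<and> y \<le> - M) \<Longrightarrow> sgn (poly P x) = sgn (poly Q y)"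
    using poly_sgn_at_infinity[OF deg(1,3)] by blast
  \<comment> \<open>Past the preimages of \<open>M\<close> and \<open>- M\<close>, monotonicity
    keeps the values of \<open>\<phi>\<close> beyond these bounds as well.\<close>
  obtain a b where ab: "\<phi> a = M" "\<phi> b = - M" using \<phi>(2) by (metis surjD)
  have "\<exists>\<theta>. strict_mono \<theta> \<and> surj \<theta> \<and> (\<forall>z\<in>Z. \<theta> z = z) \<and>
      (\<forall>x. sgn (poly P x) = sgn ((poly Q \<circ> \<phi>) (\<theta> x)))"
  proof (rule sign_match_global[where M = "max \<bar>M\<bar> (max \<bar>a\<bar> \<bar>b\<bar>)"])
    show "continuous_on UNIV (poly Q \<circ> \<phi>)"
      using strict_mono_surj_continuous[OF \<phi>]
      by (intro continuous_on_compose) (auto intro!: continuous_intros)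
  next
    fix x assume x: "max \<bar>M\<bar> (max \<bar>a\<bar> \<bar>b\<bar>) \<le> \<bar>x\<bar>"
    then consider "M \<le> x" "a \<le> x" | "x \<le> - M" "x \<le> b" by linarith
    then show "sgn (poly P x) = sgn ((poly Q \<circ> \<phi>) x)"
    proof cases
      case 1
      then have "M \<le> \<phi> x" using ab \<phi>(1) by (metis strict_mono_less_eq)
      then show ?thesis using M[of x "\<phi> x"] 1 by simp
    next
      case 2
      then have "\<phi> x \<le> - M" using ab \<phi>(1) by (metis strict_mono_less_eq)
      then show ?thesis using M[of x "\<phi> x"] 2 by simp
    qed
  qed (use finZ mono roots in \<open>auto simp: Z_def intro!: continuous_intros\<close>)
  then obtain \<theta> :: "real \<Rightarrow> real" where \<theta>: "strict_mono \<theta>" "surj \<theta>" "\<And>z. z \<in> Z \<Longrightarrow> \<theta> z = z"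
    "\<And>x. sgn (poly P x) = sgn (poly Q (\<phi> (\<theta> x)))" by auto
  have "sgn (poly p t) = sgn (poly q ((\<phi> \<circ> \<theta>) t))" if "(p, q) \<in> insert (P, Q) E" for p q t
  proof (cases "(p, q) = (P, Q) \<or> p = 0")
    \<comment> \<open>A zero polynomial contributes no points to \<open>Z\<close>, because its roots
      are not finite in number; its sign is constant anyway.\<close>
    case True
    then show ?thesis using \<theta>(4) sg[of p q "\<theta> t"] that by auto
  next
    case False
    then have "sgn (poly p t) = sgn (poly p (\<theta> t))"
      using that ZI \<theta> by (intro sgn_poly_fixing_roots) auto
    then show ?thesis using sg[of p q "\<theta> t"] that False by auto
  qed
  moreover have "strict_mono (\<phi> \<circ> \<theta>)" "surj (\<phi> \<circ> \<theta>)"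
    using \<phi> \<theta> comp_surj[of \<theta> \<phi>] by (auto simp: strict_mono_def)
  ultimately show ?thesis by (intro exI[of _ "\<phi> \<circ> \<theta>"]) auto
qed

section \<open>Quantifier elimination\<close>

definition sign_agree :: "('y \<Rightarrow> real) set \<Rightarrow> 'y \<Rightarrow> 'y \<Rightarrow> bool" where
  "sign_agree D y y' \<longleftrightarrow> (\<forall>f\<in>D. sgn (f y) = sgn (f y'))"

lemma sign_agree_sym: "sign_agree D y y' \<Longrightarrow> sign_agree D y' y"
  by (simp add: sign_agree_def)

lemma sign_agree_subset: "sign_agree D y y' \<Longrightarrow> D' \<subseteq> D \<Longrightarrow> sign_agree D' y y'"
  by (auto simp: sign_agree_def)

text \<open>For two such parameters the same sign conditions on the family are satisfiable by some
  \<open>t\<close>: a witness is transported by \<open>\<phi>\<close>. This is how a quantifier is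
  eliminated.\<close>

definition sign_equiv :: "('y \<Rightarrow> real poly) set \<Rightarrow> 'y \<Rightarrow> 'y \<Rightarrow> bool" where
  "sign_equiv F y y' \<longleftrightarrow> (\<exists>\<phi>. strict_mono \<phi> \<and> surj \<phi> \<and>
     (\<forall>p\<in>F. \<forall>t. sgn (poly (p y) t) = sgn (poly (p y') (\<phi> t))))"

lemma sign_equiv_cong:
  assumes "sign_equiv F' y y'" "\<And>p. p \<in> F \<Longrightarrow> \<exists>p'\<in>F'. p y = p' y \<and> p y' = p' y'"
  shows "sign_equiv F y y'"
  using assms unfolding sign_equiv_def by metis

lemma degree_eq_if_sgn_coeff_eq:
  fixes p q :: "real poly"
  assumes "\<And>i. sgn (coeff p i) = sgn (coeff q i)"
  shows "degree p = degree q"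
  using assms unfolding degree_def by (metis sgn_zero_iff)

section \<open>Polynomials with parameter-dependent coefficients and Hoermander's reduction\<close>

locale function_ring =
  fixes R :: "('y \<Rightarrow> real) set"
  assumes const: "(\<lambda>_. c) \<in> R"
    and add: "f \<in> R \<Longrightarrow> g \<in> R \<Longrightarrow> (\<lambda>y. f y + g y) \<in> R"
    and mult: "f \<in> R \<Longrightarrow> g \<in> R \<Longrightarrow> (\<lambda>y. f y * g y) \<in> R"
begin

lemma diff: "f \<in> R \<Longrightarrow> g \<in> R \<Longrightarrow> (\<lambda>y. f y - g y) \<in> R"
  using add[of f "\<lambda>y. (-1) * g y"] mult[OF const[of "-1"], of g] by simp

text \<open>The formal length \<open>l\<close> replaces the degree, which depends on the parameter \<open>y\<close>.\<close>

definition param_poly :: "nat \<Rightarrow> ('y \<Rightarrow> real poly) \<Rightarrow> bool" where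
  "param_poly l p \<longleftrightarrow> (\<forall>i. (\<lambda>y. coeff (p y) i) \<in> R) \<and> (\<forall>y. \<forall>i\<ge>l. coeff (p y) i = 0)"

lemma param_poly_mono: "param_poly l p \<Longrightarrow> l \<le> m \<Longrightarrow> param_poly m p"
  by (auto simp: param_poly_def)

lemma param_poly_cutoff: "param_poly l p \<Longrightarrow> param_poly k (\<lambda>y. poly_cutoff k (p y))"
proof -
  assume p: "param_poly l p"
  have "(\<lambda>y. if i < k then coeff (p y) i else 0) \<in> R" for i
    using p const[of 0] by (cases "i < k") (auto simp: param_poly_def)
  then show ?thesis by (simp add: param_poly_def coeff_poly_cutoff)
qed

lemma poly_cutoff_eq: "param_poly l p \<Longrightarrow> degree (p y) < k \<Longrightarrow> poly_cutoff k (p y) = p y"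
  by (auto simp: poly_eq_iff coeff_poly_cutoff coeff_eq_0)

lemma param_poly_pderiv: "param_poly l p \<Longrightarrow> param_poly (l - 1) (\<lambda>y. pderiv (p y))"
  using mult[OF const] by (simp add: param_poly_def coeff_pderiv del: of_nat_Suc)

text \<open>Pseudo-division: multiplying by the formal leading coefficient of \<open>q\<close>
  replaces dividing by it, so the coefficients of the remainder stay in \<open>R\<close>. The
  identity is recorded only at roots of \<open>q\<close>, where the quotient drops out.\<close>

lemma param_poly_prem:
  assumes q: "param_poly (Suc n) q"
  shows "param_poly m p \<Longrightarrow> \<exists>r j. param_poly n r \<and>
    (\<forall>y t. poly (q y) t = 0 \<longrightarrow> coeff (q y) n ^ j * poly (p y) t = poly (r y) t)"
proof (induction m arbitrary: p)
  case 0
  then show ?case by (intro exI[of _ p] exI[of _ 0]) (auto intro: param_poly_mono)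
next
  case (Suc m)
  show ?case
  proof (cases "Suc m \<le> n")
    case True
    then show ?thesis using Suc.prems
      by (intro exI[of _ p] exI[of _ 0]) (auto intro: param_poly_mono)
  next
    case False
    \<comment> \<open>The coefficients of index \<open>m\<close> cancel, and the subtracted term
      vanishes at the roots of \<open>q\<close>.\<close>
    define p' where "p' y = smult (coeff (q y) n) (p y) - monom (coeff (p y) m) (m - n) * q y" for y
    have cf: "coeff (p' y) i = coeff (q y) n * coeff (p y) i -
        (if i < m - n then 0 else coeff (p y) m * coeff (q y) (i - (m - n)))" for y i
      by (simp add: p'_def coeff_monom_mult)
    have "param_poly m p'"
      unfolding param_poly_def
    proof (intro conjI allI impI)
      fix i
      show "(\<lambda>y. coeff (p' y) i) \<in> R"
        unfolding cf using Suc.prems q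
        by (cases "i < m - n") (auto simp: param_poly_def intro!: diff mult const)
    next
      fix y i assume "m \<le> i"
      then consider "i = m" | "Suc m \<le> i" "Suc n \<le> i - (m - n)" using False by linarith
      then show "coeff (p' y) i = 0"
        using Suc.prems q False by cases (auto simp: cf param_poly_def)
    qed
    then obtain r j where r: "param_poly n r"
      "\<And>y t. poly (q y) t = 0 \<Longrightarrow> coeff (q y) n ^ j * poly (p' y) t = poly (r y) t"
      using Suc.IH by blast
    have "coeff (q y) n ^ Suc j * poly (p y) t = poly (r y) t" if "poly (q y) t = 0" for y t
      using r(2)[OF that] that by (simp add: p'_def algebra_simps)
    then show ?thesis using r(1) by blast
  qed
qed

lemma coeff_family_finite:
  assumes "finite E" "\<And>m q. (m, q) \<in> E \<Longrightarrow> param_poly m q"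
  obtains D where "finite D" "D \<subseteq> R"
    "\<And>y y' m q i. sign_agree D y y' \<Longrightarrow> (m, q) \<in> E \<Longrightarrow> sgn (coeff (q y) i) = sgn (coeff (q y') i)"
proof
  let ?D = "\<Union>(m, q)\<in>E. (\<lambda>i y. coeff (q y) i) ` {..<m}"
  show "finite ?D" using assms(1) by auto
  show "?D \<subseteq> R" using assms(2) by (auto simp: param_poly_def)
  fix y y' m q i assume "sign_agree ?D y y'" "(m, q) \<in> E"
  then show "sgn (coeff (q y) i) = sgn (coeff (q y') i)"
    using assms(2)[of m q] by (cases "i < m") (force simp: sign_agree_def param_poly_def)+
qed

text \<open>At a root of a member \<open>h\<close> of \<open>E\<close>, the value of
  \<open>P\<close> times a power of the leading coefficient of \<open>h\<close> is the value of a
  remainder. A matching of \<open>E\<close> and the remainders sends roots of \<open>h y\<close> to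
  roots of \<open>h y'\<close>, so it determines the sign of \<open>P\<close> at all these roots, as
  \<open>sign_match_extend\<close> requires. Remainders have formal length below \<open>l\<close>,
  which makes the reduction terminate.\<close>

lemma hoermander_step:
  assumes P: "param_poly l P" and "2 \<le> l"
    and E: "finite E" "\<And>m q. (m, q) \<in> E \<Longrightarrow> param_poly m q \<and> m \<le> l"
    and der: "(l - 1, \<lambda>y. pderiv (P y)) \<in> E"
  shows "\<exists>G. finite G \<and> (\<forall>(m, q)\<in>G. param_poly m q \<and> m < l) \<and>
    (\<exists>D. finite D \<and> D \<subseteq> R \<and> (\<forall>y y'. sign_agree D y y' \<longrightarrow> coeff (P y) (l - 1) \<noteq> 0 \<longrightarrow>
      sign_equiv (snd ` (E \<union> G)) y y' \<longrightarrow> sign_equiv (insert P (snd ` E)) y y'))"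
proof -
  define rem where "rem q n r j \<longleftrightarrow> param_poly n r \<and>
    (\<forall>y t. poly (poly_cutoff (Suc n) (q y)) t = 0 \<longrightarrow> coeff (q y) n ^ j * poly (P y) t = poly (r y) t)"
    for q n r j
  have "\<exists>r j. (m, q) \<in> E \<longrightarrow> rem q n r j" for m q n
    using param_poly_prem[OF param_poly_cutoff[of m q] P, of n] E(2)[of m q]
    by (auto simp: coeff_poly_cutoff rem_def)
  then have "\<forall>q n. \<exists>r j. \<forall>m. (m, q) \<in> E \<longrightarrow> rem q n r j" by metis
  then obtain r j where rj: "\<And>m q n. (m, q) \<in> E \<Longrightarrow> rem q n (r q n) (j q n)" by metis
  have r: "\<And>m q n. (m, q) \<in> E \<Longrightarrow> param_poly n (r q n)"
       "\<And>m q n y t. (m, q) \<in> E \<Longrightarrow> poly (poly_cutoff (Suc n) (q y)) t = 0 \<Longrightarrow>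
         coeff (q y) n ^ j q n * poly (P y) t = poly (r q n y) t"
    using rj by (auto simp: rem_def)
  \<comment> \<open>The actual degree of \<open>q\<close> varies with the parameter, so a remainder
    is taken for every candidate degree \<open>n < m\<close>, dividing by the cutoff of formal
    length \<open>n + 1\<close>.\<close>
  define G where "G = (\<Union>(m, q)\<in>E. (\<lambda>n. (n, r q n)) ` {..<m})"
  have "finite G" using E(1) by (auto simp: G_def)
  moreover have "param_poly m q \<and> m < l" if "(m, q) \<in> G" for m q
    using that E(2) r(1) by (fastforce simp: G_def)
  moreover have "finite (insert (l, P) E)" "\<And>m q. (m, q) \<in> insert (l, P) E \<Longrightarrow> param_poly m q"
    using E P by auto
  from coeff_family_finite[OF this] obtain D where D: "finite D" "D \<subseteq> R"
    "\<And>y y' m q i. sign_agree D y y' \<Longrightarrow> (m, q) \<in> insert (l, P) E \<Longrightarrow>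
       sgn (coeff (q y) i) = sgn (coeff (q y') i)"
    by blast
  have "sign_equiv (insert P (snd ` E)) y y'"
    if ag: "sign_agree D y y'" and lc: "coeff (P y) (l - 1) \<noteq> 0"
      and eq: "sign_equiv (snd ` (E \<union> G)) y y'" for y y'
  proof -
    obtain \<phi> where \<phi>: "strict_mono \<phi>" "surj \<phi>"
      "\<And>m q t. (m, q) \<in> E \<union> G \<Longrightarrow> sgn (poly (q y) t) = sgn (poly (q y') (\<phi> t))"
      using eq unfolding sign_equiv_def by force
    have "\<exists>\<psi>. strict_mono \<psi> \<and> surj \<psi> \<and>
      (\<forall>(p, q)\<in>insert (P y, P y') ((\<lambda>e. (snd e y, snd e y')) ` E). \<forall>t. sgn (poly p t) = sgn (poly q (\<psi> t)))"
    proof (rule sign_match_extend[OF \<phi>(1,2)])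
      show "(pderiv (P y), pderiv (P y')) \<in> (\<lambda>e. (snd e y, snd e y')) ` E"
        using der by force
      show deg: "degree (P y) = degree (P y')" using D(3)[OF ag] by (intro degree_eq_if_sgn_coeff_eq) auto
      show "sgn (lead_coeff (P y)) = sgn (lead_coeff (P y'))"
        using D(3)[OF ag, of l P] deg by auto
      show "degree (P y) \<noteq> 0"
        using le_degree[OF lc] \<open>2 \<le> l\<close> by linarith
    next
      fix p q z
      assume "(p, q) \<in> (\<lambda>e. (snd e y, snd e y')) ` E" and nz: "p \<noteq> 0" and root: "poly p z = 0"
      then obtain m h where h: "(m, h) \<in> E" "p = h y" "q = h y'" by auto
      \<comment> \<open>This is the actual degree at both parameters. The cutoff therefore leaves
        \<open>h\<close> unchanged at both, and its coefficient of index \<open>n\<close> is the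
        nonzero leading one.\<close>
      define n where "n = degree (h y)"
      have n': "degree (h y') = n"
        unfolding n_def using D(3)[OF ag, of m h] h(1) by (intro degree_eq_if_sgn_coeff_eq) auto
      have c: "coeff (h y) n \<noteq> 0" using nz h by (simp add: n_def)
      then have "n < m" using E(2)[OF h(1)] by (auto simp: param_poly_def not_less[symmetric])
      then have "(n, r h n) \<in> G" using h(1) by (force simp: G_def)
      moreover have "poly (h y') (\<phi> z) = 0"
        using \<phi>(3)[of m h z] h root by (simp add: sgn_zero_iff)
      ultimately have "sgn (coeff (h y) n ^ j h n * poly (P y) z)
          = sgn (coeff (h y') n ^ j h n * poly (P y') (\<phi> z))"
        using r(2)[OF h(1), of n y z] r(2)[OF h(1), of n y' "\<phi> z"] \<phi>(3)[of n "r h n" z] root h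
          poly_cutoff_eq[of m h y "Suc n"] poly_cutoff_eq[of m h y' "Suc n"] E(2)[OF h(1)] n' n_def
        by auto
      moreover have "coeff (h y') n \<noteq> 0" using c D(3)[OF ag, of m h n] h(1) by (metis insertI2 sgn_zero_iff)
      ultimately show "sgn (poly (P y) z) = sgn (poly (P y') (\<phi> z))"
        using c D(3)[OF ag, of m h n] h(1) by (simp add: sgn_mult power_sgn sgn_zero_iff)
    next
      fix p q t assume "(p, q) \<in> (\<lambda>e. (snd e y, snd e y')) ` E"
      then obtain m h where "(m, h) \<in> E" "p = h y" "q = h y'" by auto
      then show "sgn (poly p t) = sgn (poly q (\<phi> t))" using \<phi>(3)[of m h t] by simp
    qed (use E(1) in auto)
    then show ?thesis unfolding sign_equiv_def by auto
  qed
  ultimately show ?thesis using D(1,2) by blast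
qed

text \<open>Well-founded induction on the multiset of formal lengths: one polynomial of maximal
  length is exchanged for finitely many shorter ones. Polynomials may keep the maximal length as
  long as one of them is removed, hence the multiset order.\<close>

lemma sign_equiv_determined:
  assumes "\<And>l p. (l, p) \<in># M \<Longrightarrow> param_poly l p"
  shows "\<exists>D. finite D \<and> D \<subseteq> R \<and>
    (\<forall>y y'. sign_agree D y y' \<longrightarrow> sign_equiv (snd ` set_mset M) y y')"
  using assms
proof (induction M rule: wf_induct_rule[OF wf_inv_image[OF wf_mult1[OF wf_less_than], of "image_mset fst"]])
  case (1 M)
  have IH: "\<exists>D. finite D \<and> D \<subseteq> R \<and>
    (\<forall>y y'. sign_agree D y y' \<longrightarrow> sign_equiv (snd ` set_mset (M0 + K)) y y')"
    if "M = add_mset (l, P) M0" "\<And>m q. (m, q) \<in># K \<Longrightarrow> param_poly m q \<and> m < l" for l P M0 K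
  proof (rule 1)
    show "(M0 + K, M) \<in> inv_image (mult1 less_than) (image_mset fst)"
      using that by (auto intro!: mult1I[of _ l "image_mset fst M0" _ "image_mset fst K"])
    show "param_poly l' p" if "(l', p) \<in># M0 + K" for l' p
      using that 1(2)[of l' p] \<open>M = _\<close> \<open>\<And>m q. (m, q) \<in># K \<Longrightarrow> param_poly m q \<and> m < l\<close> by auto
  qed
  show ?case
  proof (cases "\<exists>e\<in>#M. 2 \<le> fst e")
    \<comment> \<open>All members are constant in \<open>t\<close>, so the signs of their
      coefficients suffice and the identity matches them.\<close>
    case False
    obtain D where D: "finite D" "D \<subseteq> R"
      "\<And>y y' m q i. sign_agree D y y' \<Longrightarrow> (m, q) \<in> set_mset M \<Longrightarrow>
         sgn (coeff (q y) i) = sgn (coeff (q y') i)"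
      using coeff_family_finite[OF finite_set_mset 1(2)] by blast
    have "sign_equiv (snd ` set_mset M) y y'" if ag: "sign_agree D y y'" for y y'
      unfolding sign_equiv_def
    proof (intro exI[of _ id] conjI ballI allI)
      fix p t assume "p \<in> snd ` set_mset M"
      then obtain m where m: "(m, p) \<in># M" by auto
      then have "m < 2" using False by force
      then have "degree (p y) = 0" for y
        using 1(2)[OF m] by (auto simp: param_poly_def intro!: le_antisym degree_le)
      then have "poly (p y) t = coeff (p y) 0" for y t
        by (metis degree_eq_zeroE coeff_pCons_0 mult_zero_right add.right_neutral poly_0 poly_pCons)
      then show "sgn (poly (p y) t) = sgn (poly (p y') (id t))" using D(3)[OF ag m] by simp
    qed (auto simp: strict_mono_def)
    then show ?thesis using D by blast
  next
    case True
    define l where "l = Max (fst ` set_mset M)"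
    have "l \<in> fst ` set_mset M" unfolding l_def using True by (intro Max_in) auto
    then obtain P where PM: "(l, P) \<in># M" by auto
    have lmax: "m \<le> l" if "(m, q) \<in># M" for m q
      unfolding l_def using that by (intro Max_ge) (auto simp: image_iff intro!: bexI)
    then have l2: "2 \<le> l" using True by force
    obtain M0 where M0: "M = add_mset (l, P) M0" using PM by (metis multi_member_split)
    have P: "param_poly l P" using 1(2) PM .
    \<comment> \<open>First case: where the formal leading coefficient of \<open>P\<close> vanishes,
      \<open>P\<close> equals its cutoff, which is formally shorter.\<close>
    define C where "C = (l - 1, \<lambda>y. poly_cutoff (l - 1) (P y))"
    have "param_poly (l - 1) (\<lambda>y. poly_cutoff (l - 1) (P y))"
      using param_poly_cutoff[OF P] .
    then have "\<exists>D. finite D \<and> D \<subseteq> R \<and>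
      (\<forall>y y'. sign_agree D y y' \<longrightarrow> sign_equiv (snd ` set_mset (M0 + {#C#})) y y')"
      using l2 by (intro IH[OF M0]) (auto simp: C_def)
    then obtain D1 where D1: "finite D1" "D1 \<subseteq> R"
      "\<And>y y'. sign_agree D1 y y' \<Longrightarrow> sign_equiv (snd ` set_mset (M0 + {#C#})) y y'" by blast
    define E where "E = insert (l - 1, \<lambda>y. pderiv (P y)) (set_mset M0)"
    have E: "finite E" "\<And>m q. (m, q) \<in> E \<Longrightarrow> param_poly m q \<and> m \<le> l"
      using 1(2) lmax M0 param_poly_pderiv[OF P] by (auto simp: E_def)
    have der: "(l - 1, \<lambda>y. pderiv (P y)) \<in> E" by (simp add: E_def)
    have step: "\<exists>G. finite G \<and> (\<forall>(m, q)\<in>G. param_poly m q \<and> m < l) \<and>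
      (\<exists>D. finite D \<and> D \<subseteq> R \<and> (\<forall>y y'. sign_agree D y y' \<longrightarrow> coeff (P y) (l - 1) \<noteq> 0 \<longrightarrow>
        sign_equiv (snd ` (E \<union> G)) y y' \<longrightarrow> sign_equiv (insert P (snd ` E)) y y'))"
      by (rule hoermander_step[OF P l2 E(1) _ der]) (rule E(2))
    obtain G where G: "finite G" "\<And>m q. (m, q) \<in> G \<Longrightarrow> param_poly m q \<and> m < l"
      and "\<exists>D. finite D \<and> D \<subseteq> R \<and> (\<forall>y y'. sign_agree D y y' \<longrightarrow> coeff (P y) (l - 1) \<noteq> 0 \<longrightarrow>
        sign_equiv (snd ` (E \<union> G)) y y' \<longrightarrow> sign_equiv (insert P (snd ` E)) y y')"
      by (rule exE[OF step], elim conjE) (simp add: split_beta Ball_def)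
    then obtain D2 where D2: "finite D2" "D2 \<subseteq> R"
      "\<And>y y'. sign_agree D2 y y' \<Longrightarrow> coeff (P y) (l - 1) \<noteq> 0 \<Longrightarrow>
        sign_equiv (snd ` (E \<union> G)) y y' \<Longrightarrow> sign_equiv (insert P (snd ` E)) y y'"
      by (elim exE conjE) simp
    \<comment> \<open>Second case: where that coefficient is nonzero, \<open>P\<close> gives way to
      its derivative and the remainders in \<open>G\<close>, all of formal length below
      \<open>l\<close>.\<close>
    let ?K = "mset_set (insert (l - 1, \<lambda>y. pderiv (P y)) G)"
    have "\<exists>D. finite D \<and> D \<subseteq> R \<and>
      (\<forall>y y'. sign_agree D y y' \<longrightarrow> sign_equiv (snd ` set_mset (M0 + ?K)) y y')"
      using l2 G param_poly_pderiv[OF P] by (intro IH[OF M0]) auto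
    moreover have "set_mset (M0 + ?K) = E \<union> G" using G(1) by (auto simp: E_def)
    ultimately obtain D3 where D3: "finite D3" "D3 \<subseteq> R"
      "\<And>y y'. sign_agree D3 y y' \<Longrightarrow> sign_equiv (snd ` (E \<union> G)) y y'" by auto
    let ?lc = "\<lambda>y. coeff (P y) (l - 1)"
    \<comment> \<open>With the formal leading coefficient in \<open>D\<close>, two agreeing
      parameters always fall under the same case.\<close>
    define D where "D = insert ?lc (D1 \<union> D2 \<union> D3)"
    have "sign_equiv (snd ` set_mset M) y y'" if ag: "sign_agree D y y'" for y y'
    proof (cases "?lc y = 0")
      case True
      then have "?lc y' = 0" using ag by (simp add: D_def sign_agree_def sgn_zero_iff)
      have cut: "poly_cutoff (l - 1) (P x) = P x" if "?lc x = 0" for x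
      proof (rule poly_eqI)
        fix i
        consider "i < l - 1" | "i = l - 1" | "l \<le> i" by linarith
        then show "coeff (poly_cutoff (l - 1) (P x)) i = coeff (P x) i"
          using P that by cases (auto simp: coeff_poly_cutoff param_poly_def)
      qed
      have "sign_equiv (snd ` set_mset (M0 + {#C#})) y y'"
        using D1(3) ag by (auto simp: D_def intro: sign_agree_subset)
      then show ?thesis
        by (rule sign_equiv_cong) (use cut True \<open>?lc y' = 0\<close> in \<open>auto simp: M0 C_def\<close>)
    next
      case False
      have "sign_equiv (insert P (snd ` E)) y y'"
        using False ag by (intro D2(3) D3(3)) (auto simp: D_def intro: sign_agree_subset)
      then show ?thesis
        by (rule sign_equiv_cong) (auto simp: M0 E_def)
    qed
    moreover have "finite D" "D \<subseteq> R" using D1 D2 D3 P by (auto simp: D_def param_poly_def)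
    ultimately show ?thesis by blast
  qed
qed

end

section \<open>Semialgebraic predicates and elimination of quantifiers\<close>

inductive polyfun :: "(('v \<Rightarrow> real) \<Rightarrow> real) \<Rightarrow> bool" where
  polyfun_const: "polyfun (\<lambda>_. c)"
| polyfun_var: "polyfun (\<lambda>y. y v)"
| polyfun_add: "polyfun f \<Longrightarrow> polyfun g \<Longrightarrow> polyfun (\<lambda>y. f y + g y)"
| polyfun_mult: "polyfun f \<Longrightarrow> polyfun g \<Longrightarrow> polyfun (\<lambda>y. f y * g y)"

lemma polyfun_diff: "polyfun f \<Longrightarrow> polyfun g \<Longrightarrow> polyfun (\<lambda>y. f y - g y)"
  using polyfun_add[OF _ polyfun_mult[OF polyfun_const[of "-1"]]] by fastforce

lemma polyfun_sum: "(\<And>i. i \<in> I \<Longrightarrow> polyfun (f i)) \<Longrightarrow> polyfun (\<lambda>y. \<Sum>i\<in>I. f i y)"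
  by (induction I rule: infinite_finite_induct) (auto intro: polyfun.intros)

lemma polyfun_prod: "(\<And>i. i \<in> I \<Longrightarrow> polyfun (f i)) \<Longrightarrow> polyfun (\<lambda>y. \<Prod>i\<in>I. f i y)"
  by (induction I rule: infinite_finite_induct) (auto intro: polyfun.intros)

lemma polyfun_power: "polyfun f \<Longrightarrow> polyfun (\<lambda>y. f y ^ n)"
  by (induction n) (auto intro: polyfun.intros)

lemmas polyfun_intros = polyfun.intros polyfun_diff polyfun_sum polyfun_prod polyfun_power

lemma polyfun_subst: "polyfun f \<Longrightarrow> (\<And>v. polyfun (h v)) \<Longrightarrow> polyfun (\<lambda>y. f (\<lambda>v. h v y))"
  by (induction rule: polyfun.induct) (auto intro: polyfun.intros)

text \<open>Semialgebraic sets are encoded without formulas, as the predicates that depend only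
  on the signs of finitely many polynomials.\<close>

definition semialgebraic :: "(('v \<Rightarrow> real) \<Rightarrow> bool) \<Rightarrow> bool" where
  "semialgebraic P \<longleftrightarrow> (\<exists>D. finite D \<and> (\<forall>f\<in>D. polyfun f) \<and>
     (\<forall>y y'. sign_agree D y y' \<longrightarrow> P y = P y'))"

lemma semialgebraic_pos: "polyfun f \<Longrightarrow> semialgebraic (\<lambda>y. 0 < f y)"
  unfolding semialgebraic_def sign_agree_def
  by (intro exI[of _ "{f}"]) (auto simp: sgn_real_def split: if_splits)

lemma semialgebraic_not: "semialgebraic P \<Longrightarrow> semialgebraic (\<lambda>y. \<not> P y)"
  unfolding semialgebraic_def by simp

lemma semialgebraic_conj:
  assumes "semialgebraic P" "semialgebraic Q"
  shows "semialgebraic (\<lambda>y. P y \<and> Q y)"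
proof -
  obtain D E where "finite D" "\<forall>f\<in>D. polyfun f" "\<And>y y'. sign_agree D y y' \<Longrightarrow> P y = P y'"
    and "finite E" "\<forall>f\<in>E. polyfun f" "\<And>y y'. sign_agree E y y' \<Longrightarrow> Q y = Q y'"
    using assms unfolding semialgebraic_def by blast
  moreover have "sign_agree D y y' \<and> sign_agree E y y'" if "sign_agree (D \<union> E) y y'"
    for y y' :: "'a \<Rightarrow> real"
    using that by (auto simp: sign_agree_def)
  ultimately show ?thesis unfolding semialgebraic_def by (intro exI[of _ "D \<union> E"]) blast
qed

lemma semialgebraic_imp: "semialgebraic P \<Longrightarrow> semialgebraic Q \<Longrightarrow> semialgebraic (\<lambda>y. P y \<longrightarrow> Q y)"
  using semialgebraic_not[OF semialgebraic_conj[OF _ semialgebraic_not]] by simp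

lemma semialgebraic_less:
  "polyfun f \<Longrightarrow> polyfun g \<Longrightarrow> semialgebraic (\<lambda>y. f y < g y)"
  using semialgebraic_pos[OF polyfun_diff] by simp

lemma semialgebraic_le:
  "polyfun f \<Longrightarrow> polyfun g \<Longrightarrow> semialgebraic (\<lambda>y. f y \<le> g y)"
  using semialgebraic_not[OF semialgebraic_less] by (simp add: not_less)

lemma semialgebraic_subst:
  assumes "semialgebraic P" "\<And>v. polyfun (h v)"
  shows "semialgebraic (\<lambda>y. P (\<lambda>v. h v y))"
proof -
  obtain D where D: "finite D" "\<forall>f\<in>D. polyfun f" "\<And>y y'. sign_agree D y y' \<Longrightarrow> P y = P y'"
    using assms(1) unfolding semialgebraic_def by blast
  have "\<forall>f\<in>D. polyfun (\<lambda>y. f (\<lambda>v. h v y))"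
    using D(2) polyfun_subst[of _ h] assms(2) by blast
  then show ?thesis
    unfolding semialgebraic_def
    using D(1,3)
    by (intro exI[of _ "(\<lambda>f y. f (\<lambda>v. h v y)) ` D"]) (auto simp: sign_agree_def)
qed

text \<open>Collecting powers of the variable \<open>k\<close> turns its elimination into a question
  about univariate polynomials with parameters. The formal length is only an upper bound, so adding
  lengths is good enough for products.\<close>

lemma polyfun_as_param_poly:
  fixes k :: 'v
  defines "R \<equiv> {c. polyfun c \<and> (\<forall>y t. c (y(k := t)) = c y)}"
  assumes "polyfun f"
  shows "\<exists>l p. function_ring.param_poly R l p \<and> (\<forall>y t. f (y(k := t)) = poly (p y) t)"
proof -
  interpret function_ring R
    by unfold_locales (auto simp: R_def intro: polyfun.intros)
  show ?thesis using assms(2)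
  proof (induction rule: polyfun.induct)
    case (polyfun_const c)
    show ?case
      by (intro exI[of _ 1] exI[of _ "\<lambda>_. [:c:]"]) (auto simp: param_poly_def coeff_pCons intro: const split: nat.split)
  next
    case (polyfun_var v)
    show ?case
    proof (cases "v = k")
      case True
      then show ?thesis
        by (intro exI[of _ 2] exI[of _ "\<lambda>_. [:0, 1:]"]) (auto simp: param_poly_def coeff_pCons intro: const split: nat.split)
    next
      case False
      then have "(\<lambda>y. y v) \<in> R" by (auto simp: R_def intro: polyfun.intros)
      then have "(\<lambda>y. coeff [:y v:] i) \<in> R" for i
        by (cases i) (auto intro: const)
      then show ?thesis using False
        by (intro exI[of _ 1] exI[of _ "\<lambda>y. [:y v:]"])
          (auto simp: param_poly_def coeff_eq_0 intro: const)
    qed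
  next
    case (polyfun_add f g)
    obtain l p where "param_poly l p" "\<And>y t. f (y(k := t)) = poly (p y) t"
      using polyfun_add.IH(1) by (elim exE conjE) simp
    moreover obtain m q where "param_poly m q" "\<And>y t. g (y(k := t)) = poly (q y) t"
      using polyfun_add.IH(2) by (elim exE conjE) simp
    moreover from calculation have "param_poly (max l m) (\<lambda>y. p y + q y)"
      by (auto simp: param_poly_def intro: add)
    ultimately show ?case
      by (intro exI[of _ "max l m"] exI[of _ "\<lambda>y. p y + q y"]) (simp del: fun_upd_apply)
  next
    case (polyfun_mult f g)
    obtain l p where p: "param_poly l p" "\<And>y t. f (y(k := t)) = poly (p y) t"
      using polyfun_mult.IH(1) by (elim exE conjE) simp
    obtain m q where q: "param_poly m q" "\<And>y t. g (y(k := t)) = poly (q y) t"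
      using polyfun_mult.IH(2) by (elim exE conjE) simp
    have sumR: "(\<lambda>y. \<Sum>j\<in>A. F j y) \<in> R" if "finite A" "\<And>j. F j \<in> R" for F and A :: "nat set"
      using that by (induction A rule: finite_induct) (auto intro: const add)
    have "param_poly (l + m) (\<lambda>y. p y * q y)"
      unfolding param_poly_def
    proof (intro conjI allI impI)
      show "(\<lambda>y. coeff (p y * q y) i) \<in> R" for i
        using p(1) q(1) unfolding coeff_mult param_poly_def by (intro sumR mult) auto
      show "coeff (p y * q y) i = 0" if "l + m \<le> i" for y i
        unfolding coeff_mult
      proof (intro sum.neutral ballI)
        fix j assume "j \<in> {..i}"
        then have "l \<le> j \<or> m \<le> i - j" using that by auto
        then show "coeff (p y) j * coeff (q y) (i - j) = 0" using p(1) q(1) by (auto simp: param_poly_def)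
      qed
    qed
    then show ?case using p(2) q(2)
      by (intro exI[of _ "l + m"] exI[of _ "\<lambda>y. p y * q y"]) (simp del: fun_upd_apply)
  qed
qed

text \<open>Moving the coordinate \<open>k\<close> makes each polynomial of \<open>D\<close>
  univariate. By \<open>sign_equiv_determined\<close>, finitely many signs at \<open>y\<close> fix
  the sign pattern along this line up to an increasing bijection \<open>\<phi>\<close>. A witness
  \<open>t\<close> for \<open>y\<close> thus gives the witness \<open>\<phi> t\<close> for any
  agreeing \<open>y'\<close>.\<close>

lemma tarski_seidenberg:
  fixes P :: "('v \<Rightarrow> real) \<Rightarrow> bool"
  assumes "semialgebraic P"
  shows "semialgebraic (\<lambda>y. \<exists>t. P (y(k := t)))"
proof -
  \<comment> \<open>The coefficients are the polynomial functions that do not change when the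
    eliminated coordinate \<open>k\<close> does.\<close>
  define R where "R = {c. polyfun c \<and> (\<forall>y t. c (y(k := t)) = c y)}"
  interpret function_ring R
    by unfold_locales (auto simp: R_def intro: polyfun.intros)
  obtain D where D: "finite D" "\<forall>f\<in>D. polyfun f" "\<And>y y'. sign_agree D y y' \<Longrightarrow> P y = P y'"
    using assms(1) unfolding semialgebraic_def by blast
  have "\<forall>f\<in>D. \<exists>e. param_poly (fst e) (snd e) \<and> (\<forall>y t. f (y(k := t)) = poly (snd e y) t)"
  proof
    fix f assume "f \<in> D"
    then obtain l p where "param_poly l p \<and> (\<forall>y t. f (y(k := t)) = poly (p y) t)"
      using D(2) polyfun_as_param_poly[of f k] unfolding R_def by blast
    then show "\<exists>e. param_poly (fst e) (snd e) \<and> (\<forall>y t. f (y(k := t)) = poly (snd e y) t)"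
      by (intro exI[of _ "(l, p)"]) (simp del: fun_upd_apply)
  qed
  from bchoice[OF this] obtain e where e: "\<And>f. f \<in> D \<Longrightarrow> param_poly (fst (e f)) (snd (e f))"
    "\<And>f y t. f \<in> D \<Longrightarrow> f (y(k := t)) = poly (snd (e f) y) t"
    by (auto simp del: fun_upd_apply)
  let ?M = "mset_set (e ` D)"
  have "\<exists>E. finite E \<and> E \<subseteq> R \<and> (\<forall>y y'. sign_agree E y y' \<longrightarrow> sign_equiv (snd ` set_mset ?M) y y')"
    by (rule sign_equiv_determined) (use D(1) e(1) in \<open>auto simp: image_iff, metis fst_conv snd_conv\<close>)
  then obtain E where E: "finite E" "E \<subseteq> R"
    "\<And>y y'. sign_agree E y y' \<Longrightarrow> sign_equiv ((\<lambda>f. snd (e f)) ` D) y y'"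
    using D(1) by (auto simp: image_image)
  have imp: "\<exists>t. P (y'(k := t))" if ag: "sign_agree E y y'" and t: "P (y(k := t))" for y y' t
  proof -
    obtain \<phi> where "\<And>f t. f \<in> D \<Longrightarrow> sgn (poly (snd (e f) y) t) = sgn (poly (snd (e f) y') (\<phi> t))"
      using E(3)[OF ag] unfolding sign_equiv_def by auto
    then have "sign_agree D (y(k := t)) (y'(k := \<phi> t))"
      by (simp add: sign_agree_def e(2))
    then show ?thesis using D(3) t by blast
  qed
  have eq: "(\<exists>t. P (y(k := t))) = (\<exists>t. P (y'(k := t)))" if ag: "sign_agree E y y'" for y y'
  proof
    assume "\<exists>t. P (y(k := t))"
    then obtain t where "P (y(k := t))" ..
    with ag show "\<exists>t. P (y'(k := t))" by (rule imp)
  next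
    assume "\<exists>t. P (y'(k := t))"
    then obtain t where "P (y'(k := t))" ..
    with sign_agree_sym[OF ag] show "\<exists>t. P (y(k := t))" by (rule imp)
  qed
  show ?thesis
    unfolding semialgebraic_def
  proof (intro exI[of _ E] conjI ballI allI impI)
    show "polyfun f" if "f \<in> E" for f using that E(2) by (auto simp: R_def)
  qed (fact E(1), rule eq)
qed

lemma semialgebraic_ex_block:
  assumes "finite K" "semialgebraic P"
  shows "semialgebraic (\<lambda>y. \<exists>z. P (\<lambda>v. if v \<in> K then z v else y v))"
  using assms(1)
proof (induction K rule: finite_induct)
  case empty
  then show ?case using assms(2) by simp
next
  case (insert k K)
  let ?Q = "\<lambda>y. \<exists>z. P (\<lambda>v. if v \<in> K then z v else y v)"
  have "(\<exists>z. P (\<lambda>v. if v \<in> insert k K then z v else y v)) = (\<exists>t. ?Q (y(k := t)))" for y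
  proof
    assume "\<exists>z. P (\<lambda>v. if v \<in> insert k K then z v else y v)"
    then obtain z where z: "P (\<lambda>v. if v \<in> insert k K then z v else y v)" ..
    have "(\<lambda>v. if v \<in> insert k K then z v else y v) = (\<lambda>v. if v \<in> K then z v else (y(k := z k)) v)"
      by auto
    then show "\<exists>t. ?Q (y(k := t))" using z by metis
  next
    assume "\<exists>t. ?Q (y(k := t))"
    then obtain t z where z: "P (\<lambda>v. if v \<in> K then z v else (y(k := t)) v)" by blast
    have "(\<lambda>v. if v \<in> insert k K then (z(k := t)) v else y v) = (\<lambda>v. if v \<in> K then z v else (y(k := t)) v)"
      using insert.hyps by auto
    then show "\<exists>z. P (\<lambda>v. if v \<in> insert k K then z v else y v)" using z by metis
  qed
  then show ?case using tarski_seidenberg[OF insert.IH] by simp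
qed

text \<open>The sum type separates the free variables, tagged \<open>Inl\<close>, from a quantified
  block, tagged \<open>Inr\<close>. The block may have an infinite index type; \<open>dep\<close>
  says that only the coordinates in \<open>K\<close> count, so the others can be set to zero and
  finitely many eliminations suffice.\<close>

lemma semialgebraic_ex:
  fixes P :: "('a + 'b \<Rightarrow> real) \<Rightarrow> bool"
  assumes P: "semialgebraic P" and "finite K"
    and dep: "\<And>y z z'. (\<And>k. k \<in> K \<Longrightarrow> z k = z' k) \<Longrightarrow> P (case_sum y z) \<Longrightarrow> P (case_sum y z')"
  shows "semialgebraic (\<lambda>y. \<exists>z. P (case_sum y z))"
proof -
  let ?h = "\<lambda>(v :: 'a + 'b) (y :: 'a \<Rightarrow> real). case_sum y (\<lambda>_. 0) v"
  have "polyfun (?h v)" for v by (cases v) (auto intro: polyfun.intros)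
  then have "semialgebraic (\<lambda>y. \<exists>z. P (\<lambda>v. if v \<in> Inr ` K then z v else ?h v y))"
    using semialgebraic_subst[OF semialgebraic_ex_block[OF _ P, of "Inr ` K"], of ?h] \<open>finite K\<close> by simp
  moreover have "(\<exists>z. P (\<lambda>v. if v \<in> Inr ` K then z v else ?h v y)) = (\<exists>z. P (case_sum y z))" for y
  proof
    assume "\<exists>z. P (\<lambda>v. if v \<in> Inr ` K then z v else ?h v y)"
    then obtain z where z: "P (\<lambda>v. if v \<in> Inr ` K then z v else ?h v y)" ..
    have "(\<lambda>v. if v \<in> Inr ` K then z v else ?h v y)
        = case_sum y (\<lambda>k. if k \<in> K then z (Inr k) else 0)"
      by (auto simp: fun_eq_iff split: sum.split)
    then show "\<exists>z. P (case_sum y z)" using z by metis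
  next
    assume "\<exists>z. P (case_sum y z)"
    then obtain z where z: "P (case_sum y z)" ..
    have "(\<lambda>v. if v \<in> Inr ` K then case_sum y z v else ?h v y)
        = case_sum y (\<lambda>k. if k \<in> K then z k else 0)"
      by (auto simp: fun_eq_iff split: sum.split)
    then have "P (\<lambda>v. if v \<in> Inr ` K then case_sum y z v else ?h v y)"
      using dep[OF _ z, of "\<lambda>k. if k \<in> K then z k else 0"] by simp
    then show "\<exists>z. P (\<lambda>v. if v \<in> Inr ` K then z v else ?h v y)" by blast
  qed
  ultimately show ?thesis by simp
qed

lemma semialgebraic_all:
  fixes P :: "('a + 'b \<Rightarrow> real) \<Rightarrow> bool"
  assumes P: "semialgebraic P" and "finite K"
    and dep: "\<And>y z z'. (\<And>k. k \<in> K \<Longrightarrow> z k = z' k) \<Longrightarrow> P (case_sum y z) \<Longrightarrow> P (case_sum y z')"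
  shows "semialgebraic (\<lambda>y. \<forall>z. P (case_sum y z))"
proof -
  have "semialgebraic (\<lambda>y. \<exists>z. \<not> P (case_sum y z))"
    using semialgebraic_ex[OF semialgebraic_not[OF P] \<open>finite K\<close>] dep by metis
  then show ?thesis using semialgebraic_not by fastforce
qed

section \<open>Semialgebraic sets and the Lojasiewicz inequality\<close>

lemma polyfun_real_polynomial:
  "polyfun f \<Longrightarrow> real_polynomial_function (\<lambda>x::real^'n. f (($) x))"
  by (induction rule: polyfun.induct) (auto intro: real_polynomial_function.intros(2-4)
    real_polynomial_function.intros(1)[OF bounded_linear_vec_nth])

lemma polyfun_continuous: "polyfun f \<Longrightarrow> continuous_on UNIV (\<lambda>x::real^'n. f (($) x))"
  by (intro continuous_at_imp_continuous_on ballI continuous_real_polymonial_function polyfun_real_polynomial)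

definition semialgebraic_set :: "(real^'n) set \<Rightarrow> bool" where
  "semialgebraic_set A \<longleftrightarrow> semialgebraic (\<lambda>y. (\<chi> i. y i) \<in> A)"

lemma semialgebraic_set_compl: "semialgebraic_set A \<Longrightarrow> semialgebraic_set (- A)"
  unfolding semialgebraic_set_def using semialgebraic_not by fastforce

lemma dist_vec_power2: "(dist x y)\<^sup>2 = (\<Sum>i\<in>UNIV. (x $ i - y $ i)\<^sup>2)" for x y :: "real^'n"
  by (simp add: dist_vec_def L2_set_def sum_nonneg dist_real_def)

lemma norm_vec_power2: "(norm x)\<^sup>2 = (\<Sum>i\<in>UNIV. (x $ i)\<^sup>2)" for x :: "real^'n"
  using dist_vec_power2[of x 0] by simp

text \<open>Membership is the formula "for every \<open>e > 0\<close> some \<open>z\<close> in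
  \<open>A\<close> is closer than \<open>e\<close>", made polynomial by squaring distances.
  \<open>P2\<close> and \<open>P1\<close> are its matrices before the quantifiers over
  \<open>z\<close> and \<open>e\<close>; the type \<open>unit\<close> indexes the single variable
  \<open>e\<close>.\<close>

lemma semialgebraic_set_closure:
  fixes A :: "(real^'n) set"
  assumes "semialgebraic_set A"
  shows "semialgebraic_set (closure A)"
proof -
  define P2 :: "(('n + unit) + 'n \<Rightarrow> real) \<Rightarrow> bool" where
    "P2 w \<longleftrightarrow> (\<chi> i. w (Inr i)) \<in> A \<and> (\<Sum>i\<in>UNIV. (w (Inr i) - w (Inl (Inl i)))\<^sup>2) < (w (Inl (Inr ())))\<^sup>2" for w
  define P1 :: "('n + unit \<Rightarrow> real) \<Rightarrow> bool" where
    "P1 w \<longleftrightarrow> (0 < w (Inr ()) \<longrightarrow> (\<exists>z. P2 (case_sum w z)))" for w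
  have "semialgebraic P2"
    unfolding P2_def
    using semialgebraic_subst[OF assms[unfolded semialgebraic_set_def], of "\<lambda>i w. w (Inr i)"]
    by (intro semialgebraic_conj semialgebraic_less polyfun_intros) (auto intro: polyfun_intros)
  then have "semialgebraic (\<lambda>w. \<exists>z. P2 (case_sum w z))"
    by (rule semialgebraic_ex[OF _ finite_class.finite_UNIV]) (metis UNIV_I ext)
  then have "semialgebraic P1"
    unfolding P1_def by (intro semialgebraic_imp semialgebraic_less polyfun_intros)
  then have "semialgebraic (\<lambda>y. \<forall>e. P1 (case_sum y e))"
    by (rule semialgebraic_all[OF _ finite_class.finite_UNIV]) (metis UNIV_I ext)
  moreover have "(\<forall>e. P1 (case_sum y e)) \<longleftrightarrow> (\<chi> i. y i) \<in> closure A" for y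
  proof -
    have P2: "P2 (case_sum (case_sum y e) z) \<longleftrightarrow> (\<chi> i. z i) \<in> A \<and> (dist (\<chi> i. z i) (\<chi> i. y i))\<^sup>2 < (e ())\<^sup>2" for e z
      by (simp add: P2_def dist_vec_power2)
    have "P1 (case_sum y e) \<longleftrightarrow> (0 < e () \<longrightarrow> (\<exists>z\<in>A. dist z (\<chi> i. y i) < e ()))" for e
    proof (cases "0 < e ()")
      case True
      have "(\<exists>z. P2 (case_sum (case_sum y e) z)) \<longleftrightarrow> (\<exists>z\<in>A. dist z (\<chi> i. y i) < e ())"
      proof
        assume "\<exists>z. P2 (case_sum (case_sum y e) z)"
        then show "\<exists>z\<in>A. dist z (\<chi> i. y i) < e ()"
          unfolding P2 using True by (meson less_imp_le power_less_imp_less_base)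
      next
        assume "\<exists>z\<in>A. dist z (\<chi> i. y i) < e ()"
        then obtain z where z: "z \<in> A" "dist z (\<chi> i. y i) < e ()" by blast
        then have "P2 (case_sum (case_sum y e) (($) z))"
          unfolding P2 by (simp add: power_strict_mono)
        then show "\<exists>z. P2 (case_sum (case_sum y e) z)" by blast
      qed
      then show ?thesis by (simp add: P1_def)
    qed (simp add: P1_def)
    moreover have "(\<forall>e. Q (e ())) \<longleftrightarrow> (\<forall>e::real. Q e)" for Q
    proof (intro iffI allI)
      fix e :: real assume "\<forall>e. Q (e ())"
      from this[rule_format, of "\<lambda>_. e"] show "Q e" .
    qed simp
    ultimately show ?thesis by (simp add: closure_approachable)
  qed
  ultimately show ?thesis by (simp add: semialgebraic_set_def)
qed

text \<open>Unfolding positive semidefiniteness gives a formula "some \<open>u\<close>, for all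
  \<open>v\<close>" over a polynomial inequality. Only \<open>N\<close> coordinates of
  \<open>u\<close> and \<open>d\<close> coordinates of \<open>v\<close> enter, so both blocks can be
  eliminated.\<close>

lemma SDP_representable_semialgebraic:
  fixes S :: "(real^'n) set"
  assumes "SDP_representable S"
  shows "semialgebraic_set S"
proof -
  obtain d N A0 and A :: "'n \<Rightarrow> nat \<Rightarrow> nat \<Rightarrow> real" and B :: "nat \<Rightarrow> nat \<Rightarrow> nat \<Rightarrow> real" where
    sym: "symmetric_matrix d A0" "\<forall>i. symmetric_matrix d (A i)" "\<forall>j<N. symmetric_matrix d (B j)"
    and S: "S = {x. \<exists>u::nat \<Rightarrow> real. positive_semidefinite d
       (\<lambda>r c. A0 r c + (\<Sum>i\<in>UNIV. x $ i * A i r c) + (\<Sum>j<N. u j * B j r c))}"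
    using assms unfolding SDP_representable_def by blast
  define P2 :: "(('n + nat) + nat \<Rightarrow> real) \<Rightarrow> bool" where
    "P2 w \<longleftrightarrow> 0 \<le> (\<Sum>r<d. \<Sum>c<d. w (Inr r) *
       (A0 r c + (\<Sum>i\<in>UNIV. w (Inl (Inl i)) * A i r c) + (\<Sum>j<N. w (Inl (Inr j)) * B j r c)) * w (Inr c))" for w
  define P1 :: "('n + nat \<Rightarrow> real) \<Rightarrow> bool" where "P1 w \<longleftrightarrow> (\<forall>v. P2 (case_sum w v))" for w
  have "semialgebraic P2"
    unfolding P2_def by (intro semialgebraic_le polyfun_intros)
  then have "semialgebraic P1"
    unfolding P1_def by (rule semialgebraic_all[of _ "{..<d}"]) (auto simp: P2_def)
  then have "semialgebraic (\<lambda>y. \<exists>u. P1 (case_sum y u))"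
    by (rule semialgebraic_ex[of _ "{..<N}"]) (auto simp: P1_def P2_def)
  moreover have "P1 (case_sum y u) \<longleftrightarrow> positive_semidefinite d
       (\<lambda>r c. A0 r c + (\<Sum>i\<in>UNIV. y i * A i r c) + (\<Sum>j<N. u j * B j r c))" for y u
    using sym by (simp add: P1_def P2_def positive_semidefinite_def symmetric_matrix_def)
  ultimately show ?thesis by (simp add: semialgebraic_set_def S)
qed

section \<open>Signs at infinity in two variables and the Lojasiewicz inequality\<close>

lemma poly_abs_le_power:
  fixes a :: "real poly"
  shows "\<exists>B k. 0 \<le> B \<and> (\<forall>r\<ge>1. \<bar>poly a r\<bar> \<le> B * r ^ k)"
proof (induction a)
  case (pCons b a)
  then obtain B k where B: "0 \<le> B" "\<And>r. r \<ge> 1 \<Longrightarrow> \<bar>poly a r\<bar> \<le> B * r ^ k" by blast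
  have "\<bar>poly (pCons b a) r\<bar> \<le> (\<bar>b\<bar> + B) * r ^ Suc k" if r: "r \<ge> 1" for r
  proof -
    have "\<bar>poly (pCons b a) r\<bar> \<le> \<bar>b\<bar> + r * \<bar>poly a r\<bar>"
      using r abs_triangle_ineq[of b "r * poly a r"] by (simp add: abs_mult)
    also have "\<dots> \<le> \<bar>b\<bar> * r ^ Suc k + r * (B * r ^ k)"
      using B(2)[OF r] r one_le_power[OF r, of "Suc k"]
      by (intro add_mono mult_left_mono) (auto simp: mult_le_cancel_left1)
    finally show ?thesis by (simp add: algebra_simps)
  qed
  then show ?case using B(1) by (intro exI[of _ "\<bar>b\<bar> + B"] exI[of _ "Suc k"]) auto
qed auto

text \<open>Here \<open>p\<close> is a polynomial in \<open>s\<close> whose coefficients are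
  polynomials in \<open>r\<close>. Where \<open>s\<close> exceeds a high power of \<open>r\<close>,
  the part divisible by \<open>s\<close> dominates the constant coefficient. The positive lower
  bound \<open>c\<close>, rather than mere positivity, carries the induction.\<close>

lemma poly_poly_sign_at_infinity:
  fixes p :: "real poly poly"
  assumes "p \<noteq> 0"
  shows "\<exists>R M c \<sigma>. 1 \<le> R \<and> 0 < c \<and> (\<forall>r\<ge>R. \<forall>s\<ge>r ^ M. c \<le> \<sigma> * poly (poly p [:s:]) r)"
  using assms
proof (induction p)
  case (pCons a p)
  show ?case
  proof (cases "p = 0")
    case True
    then have "a \<noteq> 0" using pCons.hyps by auto
    define \<sigma> where "\<sigma> = sgn (lead_coeff a)"
    have "\<sigma> * lead_coeff a = \<bar>lead_coeff a\<bar>" by (simp add: \<sigma>_def abs_sgn mult.commute)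
    moreover have "\<sigma> \<noteq> 0" using \<open>a \<noteq> 0\<close> by (simp add: \<sigma>_def sgn_zero_iff)
    ultimately have lc: "lead_coeff (smult \<sigma> a) > 0" using \<open>a \<noteq> 0\<close> by simp
    obtain n where "\<And>x. x \<ge> n \<Longrightarrow> lead_coeff (smult \<sigma> a) \<le> poly (smult \<sigma> a) x"
      using poly_pinfty_gt_lc[OF lc] by blast
    then show ?thesis using lc True
      by (intro exI[of _ "max 1 n"] exI[of _ 0] exI[of _ "lead_coeff (smult \<sigma> a)"] exI[of _ \<sigma>]) auto
  next
    case False
    then obtain R M c \<sigma> where R: "1 \<le> R" "0 < c"
      "\<And>r s. r \<ge> R \<Longrightarrow> s \<ge> r ^ M \<Longrightarrow> c \<le> \<sigma> * poly (poly p [:s:]) r" using pCons.IH by blast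
    obtain B k where B: "0 \<le> B" "\<And>r. r \<ge> 1 \<Longrightarrow> \<bar>poly (smult \<sigma> a) r\<bar> \<le> B * r ^ k"
      using poly_abs_le_power by blast
    have "1 \<le> \<sigma> * poly (poly (pCons a p) [:s:]) r"
      if r: "r \<ge> max R ((B + 1) / c)" and s: "s \<ge> r ^ max M (Suc k)" for r s
    proof -
      have r1: "1 \<le> r" using r R(1) by auto
      have "r ^ M \<le> s" "r ^ Suc k \<le> s"
        using s power_increasing[OF _ r1, of M "max M (Suc k)"] power_increasing[OF _ r1, of "Suc k" "max M (Suc k)"]
        by linarith+
      then have v: "c \<le> \<sigma> * poly (poly p [:s:]) r" using R(3) r by auto
      have "1 \<le> r ^ k" using r1 by simp
      \<comment> \<open>The threshold \<open>(B + 1) / c\<close> for \<open>r\<close> makes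
        \<open>r * c - B\<close> at least 1.\<close>
      also have "r ^ k * 1 \<le> r ^ k * (r * c - B)"
        using r R(2) r1 by (intro mult_left_mono) (auto simp: field_simps)
      also have "\<dots> = r ^ Suc k * c - B * r ^ k" by (simp add: algebra_simps)
      also have "\<dots> \<le> s * (\<sigma> * poly (poly p [:s:]) r) - B * r ^ k"
        using \<open>r ^ Suc k \<le> s\<close> v R(2) r1 by (intro diff_right_mono mult_mono) (auto intro: order_trans[rotated])
      also have "\<dots> \<le> s * (\<sigma> * poly (poly p [:s:]) r) + poly (smult \<sigma> a) r"
        using B(2)[OF r1] by linarith
      also have "\<dots> = \<sigma> * poly (poly (pCons a p) [:s:]) r" by (simp add: algebra_simps)
      finally show ?thesis by simp
    qed
    moreover have "1 \<le> max R ((B + 1) / c)" using R(1) by simp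
    ultimately show ?thesis
      by (intro exI[of _ "max R ((B + 1) / c)"] exI[of _ "max M (Suc k)"] exI[of _ 1] exI[of _ \<sigma>]) auto
  qed
qed simp

lemma polyfun_as_poly_poly:
  "polyfun f \<Longrightarrow> \<exists>p. \<forall>r s. f (\<lambda>b. if b then r else s) = poly (poly p [:s:]) r"
proof (induction rule: polyfun.induct)
  case (polyfun_const c)
  show ?case by (intro exI[of _ "[:[:c:]:]"]) simp
next
  case (polyfun_var v)
  show ?case by (intro exI[of _ "if v then [:[:0, 1:]:] else [:0, 1:]"]) auto
next
  case (polyfun_add f g)
  then obtain p q where "\<And>r s. f (\<lambda>b. if b then r else s) = poly (poly p [:s:]) r"
    "\<And>r s. g (\<lambda>b. if b then r else s) = poly (poly q [:s:]) r" by metis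
  then show ?case by (intro exI[of _ "p + q"]) simp
next
  case (polyfun_mult f g)
  then obtain p q where "\<And>r s. f (\<lambda>b. if b then r else s) = poly (poly p [:s:]) r"
    "\<And>r s. g (\<lambda>b. if b then r else s) = poly (poly q [:s:]) r" by metis
  then show ?case by (intro exI[of _ "p * q"]) simp
qed

lemma polyfun_sgn_at_infinity:
  assumes "polyfun f"
  shows "\<exists>R M. 1 \<le> R \<and> (\<exists>\<sigma>. \<forall>r\<ge>R. \<forall>s\<ge>r ^ M. sgn (f (\<lambda>b. if b then r else s)) = \<sigma>)"
proof -
  obtain p where p: "\<And>r s. f (\<lambda>b. if b then r else s) = poly (poly p [:s:]) r"
    using polyfun_as_poly_poly[OF assms] by blast
  show ?thesis
  proof (cases "p = 0")
    case True
    then show ?thesis by (intro exI[of _ 1] exI[of _ 0]) (auto simp: p)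
  next
    case False
    then obtain R M c \<sigma> where R: "1 \<le> R" "0 < c"
      "\<And>r s. r \<ge> R \<Longrightarrow> s \<ge> r ^ M \<Longrightarrow> c \<le> \<sigma> * poly (poly p [:s:]) r"
      using poly_poly_sign_at_infinity by blast
    have "sgn (f (\<lambda>b. if b then r else s)) = sgn \<sigma>" if "r \<ge> R" "s \<ge> r ^ M" for r s
    proof -
      have "0 < \<sigma> * poly (poly p [:s:]) r" using R(2) R(3)[OF that] by linarith
      then show ?thesis by (auto simp: p zero_less_mult_iff)
    qed
    then show ?thesis using R(1) by blast
  qed
qed

text \<open>Finitely many polynomials in \<open>r\<close> and \<open>s\<close> have constant signs
  on a common region \<open>r \<ge> R\<close>, \<open>s \<ge> r ^ M\<close>. This is the source of
  the polynomial growth bound in \<open>lojasiewicz\<close>.\<close>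

lemma semialgebraic_eventually_constant:
  fixes Q :: "(bool \<Rightarrow> real) \<Rightarrow> bool"
  assumes "semialgebraic Q"
  shows "\<exists>R M. 1 \<le> R \<and>
    (\<forall>r\<ge>R. \<forall>s\<ge>r ^ M. Q (\<lambda>b. if b then r else s) = Q (\<lambda>b. if b then R else R ^ M))"
proof -
  obtain D where D: "finite D" "\<forall>f\<in>D. polyfun f" "\<And>y y'. sign_agree D y y' \<Longrightarrow> Q y = Q y'"
    using assms unfolding semialgebraic_def by blast
  have "\<exists>R M. 1 \<le> R \<and> (\<forall>r\<ge>R. \<forall>s\<ge>r ^ M. \<forall>r'\<ge>R. \<forall>s'\<ge>r' ^ M.
      sign_agree D (\<lambda>b. if b then r else s) (\<lambda>b. if b then r' else s'))"
    using D(1,2)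
  proof (induction D rule: finite_induct)
    case empty
    then show ?case by (auto simp: sign_agree_def)
  next
    case (insert f D)
    then obtain R M where R: "1 \<le> R" "\<forall>r\<ge>R. \<forall>s\<ge>r ^ M. \<forall>r'\<ge>R. \<forall>s'\<ge>r' ^ M.
      sign_agree D (\<lambda>b. if b then r else s) (\<lambda>b. if b then r' else s')" by auto
    have "polyfun f" using insert.prems by simp
    from polyfun_sgn_at_infinity[OF this] obtain R1 M1 \<sigma> where
      R1: "1 \<le> R1" "\<forall>r\<ge>R1. \<forall>s\<ge>r ^ M1. sgn (f (\<lambda>b. if b then r else s)) = \<sigma>" by blast
    have "sign_agree (insert f D) (\<lambda>b. if b then r else s) (\<lambda>b. if b then r' else s')"
      if "r \<ge> max R R1" "s \<ge> r ^ max M M1" "r' \<ge> max R R1" "s' \<ge> r' ^ max M M1" for r s r' s'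
    proof -
      have "r ^ M \<le> r ^ max M M1" "r ^ M1 \<le> r ^ max M M1" "r' ^ M \<le> r' ^ max M M1" "r' ^ M1 \<le> r' ^ max M M1"
        using that R(1) by (auto intro!: power_increasing)
      then show ?thesis using that R(2)[rule_format, of r s r' s'] R1(2)[rule_format, of r s] R1(2)[rule_format, of r' s'] by (auto simp: sign_agree_def)
    qed
    then show ?case using R(1) by (intro exI[of _ "max R R1"] exI[of _ "max M M1"]) auto
  qed
  then obtain R M where R: "1 \<le> R" "\<forall>r\<ge>R. \<forall>s\<ge>r ^ M. \<forall>r'\<ge>R. \<forall>s'\<ge>r' ^ M.
      sign_agree D (\<lambda>b. if b then r else s) (\<lambda>b. if b then r' else s')" by blast
  have "Q (\<lambda>b. if b then r else s) = Q (\<lambda>b. if b then R else R ^ M)" if "r \<ge> R" "s \<ge> r ^ M" for r s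
    using R(2)[rule_format, of r s R "R ^ M"] that by (intro D(3)) simp
  then show ?thesis using R(1) by blast
qed

text \<open>The sets \<open>K r\<close> below are compact and exhaust the part of \<open>F\<close>
  where \<open>g > 0\<close>. The statement that \<open>f * s \<le> 1\<close> somewhere on
  \<open>K r\<close> is semialgebraic in \<open>r\<close> and \<open>s\<close>, hence constant on a
  region \<open>r \<ge> R\<close>, \<open>s \<ge> r ^ M\<close>. Compactness makes it false at one
  point of that region, so it is false at \<open>s = r ^ M\<close>, that is,
  \<open>f * r ^ M > 1\<close> on \<open>K r\<close> for every \<open>r \<ge> R\<close>.\<close>

lemma lojasiewicz:
  fixes F :: "(real^'n) set"
  assumes F: "closed F" "semialgebraic_set F" and f: "polyfun f" and g: "polyfun g"
    and pos: "\<And>x. x \<in> F \<Longrightarrow> 0 < g (($) x) \<Longrightarrow> 0 < f (($) x)"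
  shows "\<exists>R M. \<forall>x\<in>F. 0 < g (($) x) \<longrightarrow>
    g (($) x) ^ M < f (($) x) * ((R + (norm x)\<^sup>2) * g (($) x) + 1) ^ M"
proof -
  define Q' :: "(bool + 'n \<Rightarrow> real) \<Rightarrow> bool" where
    "Q' w \<longleftrightarrow> (\<chi> i. w (Inr i)) \<in> F \<and> (\<Sum>i\<in>UNIV. (w (Inr i))\<^sup>2) \<le> w (Inl True) \<and>
      1 \<le> g (\<lambda>i. w (Inr i)) * w (Inl True) \<and> f (\<lambda>i. w (Inr i)) * w (Inl False) \<le> 1" for w
  have "semialgebraic Q'"
    unfolding Q'_def
    using semialgebraic_subst[OF F(2)[unfolded semialgebraic_set_def], of "\<lambda>i w. w (Inr i)"]
    by (intro semialgebraic_conj semialgebraic_le polyfun_intros polyfun_subst[OF f] polyfun_subst[OF g])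
      (auto intro: polyfun_intros)
  then have "semialgebraic (\<lambda>w. \<exists>z. Q' (case_sum w z))"
    by (rule semialgebraic_ex[OF _ finite_class.finite_UNIV]) (metis UNIV_I ext)
  from semialgebraic_eventually_constant[OF this] obtain R M where R: "1 \<le> R"
    "\<forall>r\<ge>R. \<forall>s\<ge>r ^ M. (\<exists>z. Q' (case_sum (\<lambda>b. if b then r else s) z)) =
      (\<exists>z. Q' (case_sum (\<lambda>b. if b then R else R ^ M) z))" by blast
  define K where "K r = {x \<in> F. (norm x)\<^sup>2 \<le> r \<and> 1 \<le> g (($) x) * r}" for r
  have Q': "Q' (case_sum (\<lambda>b. if b then r else s) z) \<longleftrightarrow> (\<chi> i. z i) \<in> K r \<and> f z * s \<le> 1" for r s z
    by (auto simp: Q'_def K_def norm_vec_power2 vec_lambda_inverse)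
  have ex: "(\<exists>z. Q' (case_sum (\<lambda>b. if b then r else s) z)) \<longleftrightarrow> (\<exists>x\<in>K r. f (($) x) * s \<le> 1)" for r s
  proof
    assume "\<exists>z. Q' (case_sum (\<lambda>b. if b then r else s) z)"
    then obtain z where "Q' (case_sum (\<lambda>b. if b then r else s) z)" ..
    then show "\<exists>x\<in>K r. f (($) x) * s \<le> 1"
      unfolding Q' by (intro bexI[of _ "\<chi> i. z i"]) (auto simp: vec_lambda_inverse)
  next
    assume "\<exists>x\<in>K r. f (($) x) * s \<le> 1"
    then obtain x where "x \<in> K r" "f (($) x) * s \<le> 1" by blast
    then show "\<exists>z. Q' (case_sum (\<lambda>b. if b then r else s) z)"
      unfolding Q' by (intro exI[of _ "($) x"]) auto
  qed
  \<comment> \<open>On the compact set \<open>K R\<close> the function \<open>f\<close> has a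
    positive minimum, so a large enough \<open>s\<close> refutes the condition there.\<close>
  have "\<exists>s\<ge>R ^ M. \<not> (\<exists>x\<in>K R. f (($) x) * s \<le> 1)"
  proof (cases "K R = {}")
    case False
    have "K R = F \<inter> {x. (norm x)\<^sup>2 \<le> R} \<inter> {x. 1 \<le> g (($) x) * R}" by (auto simp: K_def)
    moreover have "closed {x::real^'n. (norm x)\<^sup>2 \<le> R}" "closed {x::real^'n. 1 \<le> g (($) x) * R}"
      by (intro closed_Collect_le continuous_intros polyfun_continuous g)+
    ultimately have "closed (K R)" using F(1) by auto
    moreover have "bounded (K R)"
      by (rule boundedI[of _ "sqrt R"]) (auto simp: K_def intro: real_le_rsqrt)
    ultimately have "compact (K R)" by (simp add: compact_eq_bounded_closed)
    then obtain x0 where x0: "x0 \<in> K R" "\<And>x. x \<in> K R \<Longrightarrow> f (($) x0) \<le> f (($) x)"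
      using continuous_attains_inf[OF _ False, of "\<lambda>x. f (($) x)"] polyfun_continuous[OF f]
        continuous_on_subset[OF _ subset_UNIV] by blast
    have fp: "0 < f (($) x0)"
    proof (rule pos)
      have "0 < g (($) x0) * R" using x0(1) by (auto simp: K_def)
      then show "0 < g (($) x0)" using R(1) by (auto simp: zero_less_mult_iff)
    qed (use x0 in \<open>auto simp: K_def\<close>)
    define s where "s = max (R ^ M) (2 / f (($) x0))"
    have "1 < f (($) x) * s" if "x \<in> K R" for x
    proof -
      have "1 < f (($) x0) * (2 / f (($) x0))" using fp by simp
      also have "\<dots> \<le> f (($) x) * s"
        using x0(2)[OF that] fp by (intro mult_mono) (auto simp: s_def)
      finally show ?thesis .
    qed
    then show ?thesis by (intro exI[of _ s]) (auto simp: s_def not_le)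
  qed auto
  then obtain s0 where s0: "s0 \<ge> R ^ M" "\<not> (\<exists>x\<in>K R. f (($) x) * s0 \<le> 1)" by blast
  note R' = R(2)[unfolded ex, rule_format]
  have none: "\<not> (\<exists>x\<in>K R. f (($) x) * R ^ M \<le> 1)"
    using R'[OF order_refl s0(1)] s0(2) by simp
  have key: "1 < f (($) x) * r ^ M" if "r \<ge> R" "x \<in> K r" for r x
  proof -
    have "\<not> (\<exists>x\<in>K r. f (($) x) * r ^ M \<le> 1)"
      using R'[OF that(1) order_refl] none by simp
    then show ?thesis using that(2) by (simp add: not_le)
  qed
  have "g (($) x) ^ M < f (($) x) * ((R + (norm x)\<^sup>2) * g (($) x) + 1) ^ M"
    if x: "x \<in> F" and gp: "0 < g (($) x)" for x
  proof -
    \<comment> \<open>Each summand secures one requirement: \<open>r \<ge> R\<close>, the norm bound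
      and \<open>g * r \<ge> 1\<close>. Multiplying by \<open>g ^ M\<close> then clears the
      denominator.\<close>
    define r where "r = R + (norm x)\<^sup>2 + 1 / g (($) x)"
    have gr: "g (($) x) * r = (R + (norm x)\<^sup>2) * g (($) x) + 1"
      using gp by (simp add: r_def field_simps)
    have "1 \<le> g (($) x) * r" unfolding gr using gp R(1) by simp
    moreover have "R \<le> r" "(norm x)\<^sup>2 \<le> r" using gp R(1) by (auto simp: r_def)
    ultimately have "r \<ge> R" "x \<in> K r" using x by (auto simp: K_def)
    then have "g (($) x) ^ M * 1 < g (($) x) ^ M * (f (($) x) * r ^ M)"
      using key gp by (intro mult_strict_left_mono) auto
    also have "\<dots> = f (($) x) * (g (($) x) * r) ^ M" by (simp add: power_mult_distrib)
    finally show ?thesis by (simp add: gr)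
  qed
  then show ?thesis by blast
qed

section \<open>Unions of basic semialgebraic sets\<close>

lemma basic_open_set_eq: "basic_open_set gs = {x. \<forall>g\<in>set gs. 0 < g x}"
  by (auto simp: basic_open_set_def all_set_conv_all_nth)

lemma basic_closed_set_eq: "basic_closed_set gs = {x. \<forall>g\<in>set gs. 0 \<le> g x}"
  by (auto simp: basic_closed_set_def all_set_conv_all_nth)

lemma semialgebraic_finite_all:
  "finite D \<Longrightarrow> (\<And>f. f \<in> D \<Longrightarrow> semialgebraic (P f)) \<Longrightarrow> semialgebraic (\<lambda>y. \<forall>f\<in>D. P f y)"
proof (induction D rule: finite_induct)
  case empty
  then show ?case by (auto simp: semialgebraic_def)
next
  case (insert f D)
  then show ?case using semialgebraic_conj[of "P f" "\<lambda>y. \<forall>f\<in>D. P f y"] by simp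
qed

text \<open>The polynomial \<open>h\<close> below is positive on the class, where
  \<open>f0 = 0\<close> and \<open>g > 0\<close>, and negative at the points of \<open>F\<close>
  with \<open>g > 0\<close>, by \<open>lojasiewicz\<close>. Hence the condition \<open>h > 0\<close>
  can replace the equations while the strict inequalities are kept.\<close>

lemma sign_class_in_basic_open:
  fixes U :: "(real^'n) set"
  assumes U: "open U" "semialgebraic_set U"
    and D: "finite D" "\<forall>f\<in>D. polyfun f"
    and \<tau>: "\<forall>f\<in>D. \<tau> f \<in> {-1, 0, 1}"
    and sub: "{x. \<forall>f\<in>D. sgn (f (($) x)) = \<tau> f} \<subseteq> U"
  shows "\<exists>gs. (\<forall>g\<in>set gs. real_polynomial_function g) \<and>
    {x. \<forall>f\<in>D. sgn (f (($) x)) = \<tau> f} \<subseteq> basic_open_set gs \<and> basic_open_set gs \<subseteq> U"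
proof -
  define D1 where "D1 = {f \<in> D. \<tau> f \<noteq> 0}"
  define f0 where "f0 y = (\<Sum>f\<in>D - D1. (f y)\<^sup>2)" for y
  define g where "g y = (\<Prod>f\<in>D1. \<tau> f * f y)" for y
  \<comment> \<open>Weak inequalities keep \<open>F\<close> closed. Where \<open>g > 0\<close>, no
    factor of the product vanishes, so they become strict.\<close>
  define F where "F = - U \<inter> {x. \<forall>f\<in>D1. 0 \<le> \<tau> f * f (($) x)}"
  have D1: "finite D1" "\<And>f. f \<in> D1 \<Longrightarrow> polyfun (\<lambda>y. \<tau> f * f y)"
    using D by (auto simp: D1_def intro: polyfun_intros)
  have "polyfun f0" "polyfun g"
    unfolding f0_def g_def using D by (auto simp: D1_def intro!: polyfun_intros)
  have f0_nonneg: "0 \<le> f0 y" for y by (simp add: f0_def sum_nonneg)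
  have classI: "sgn (f (($) x)) = \<tau> f" if "f0 (($) x) = 0" "\<And>f. f \<in> D1 \<Longrightarrow> 0 < \<tau> f * f (($) x)" "f \<in> D" for x f
  proof (cases "f \<in> D1")
    case True
    then show ?thesis using that(2)[OF True] \<tau> that(3) by (auto simp: sgn_real_def zero_less_mult_iff)
  next
    case False
    then have "f (($) x) = 0"
      using that(1,3) D(1) by (auto simp: f0_def sum_nonneg_eq_0_iff)
    then show ?thesis using False that(3) by (simp add: D1_def)
  qed
  have "closed {x::real^'n. \<forall>f\<in>D1. 0 \<le> \<tau> f * f (($) x)}"
  proof -
    have "{x. \<forall>f\<in>D1. 0 \<le> \<tau> f * f (($) x)} = (\<Inter>f\<in>D1. {x::real^'n. 0 \<le> \<tau> f * f (($) x)})" by auto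
    then show ?thesis
      using polyfun_continuous[OF D1(2)] by (auto intro!: closed_INT closed_Collect_le)
  qed
  then have closedF: "closed F" using U(1) by (auto simp: F_def)
  have "semialgebraic (\<lambda>y. \<forall>f\<in>D1. 0 \<le> \<tau> f * f y)"
    by (intro semialgebraic_finite_all semialgebraic_le polyfun_const D1)
  then have saF: "semialgebraic_set F"
    using semialgebraic_conj[OF semialgebraic_set_compl[OF U(2), unfolded semialgebraic_set_def]]
    by (simp add: semialgebraic_set_def F_def vec_lambda_inverse)
  have "0 < f0 (($) x)" if x: "x \<in> F" "0 < g (($) x)" for x
  proof (rule ccontr)
    assume "\<not> ?thesis"
    then have "f0 (($) x) = 0" using f0_nonneg[of "($) x"] by simp
    moreover have "0 < \<tau> f * f (($) x)" if "f \<in> D1" for f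
    proof -
      have "\<tau> f * f (($) x) \<noteq> 0"
        using x(2) D1(1) that unfolding g_def by (metis less_irrefl prod_zero)
      then show ?thesis using x(1) that by (auto simp: F_def less_le)
    qed
    ultimately have "x \<in> U" using classI sub by blast
    then show False using x(1) by (simp add: F_def)
  qed
  then obtain R M where RM: "\<forall>x\<in>F. 0 < g (($) x) \<longrightarrow>
    g (($) x) ^ M < f0 (($) x) * ((R + (norm x)\<^sup>2) * g (($) x) + 1) ^ M"
    using lojasiewicz[OF closedF saF \<open>polyfun f0\<close> \<open>polyfun g\<close>] by blast
  define h where "h y = g y ^ M - f0 y * ((R + (\<Sum>i\<in>UNIV. (y i)\<^sup>2)) * g y + 1) ^ M" for y
  have "polyfun h"
    unfolding h_def by (intro polyfun_intros \<open>polyfun f0\<close> \<open>polyfun g\<close>)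
  obtain fs where fs: "set fs = D1" using D1(1) finite_list by blast
  define gs :: "(real^'n \<Rightarrow> real) list" where
    "gs = (\<lambda>x. h (($) x)) # map (\<lambda>f x. \<tau> f * f (($) x)) fs"
  have open_eq: "basic_open_set gs = {x. 0 < h (($) x) \<and> (\<forall>f\<in>D1. 0 < \<tau> f * f (($) x))}"
    by (auto simp: basic_open_set_eq gs_def fs)
  have gpos: "0 < g (($) x)" if "\<forall>f\<in>D1. 0 < \<tau> f * f (($) x)" for x :: "real^'n"
    using that by (auto simp: g_def intro: prod_pos)
  have "\<forall>g\<in>set gs. real_polynomial_function g"
    using polyfun_real_polynomial[OF \<open>polyfun h\<close>] polyfun_real_polynomial[OF D1(2)]
    by (auto simp: gs_def fs)
  moreover have "{x. \<forall>f\<in>D. sgn (f (($) x)) = \<tau> f} \<subseteq> basic_open_set gs"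
  proof
    fix x assume "x \<in> {x. \<forall>f\<in>D. sgn (f (($) x)) = \<tau> f}"
    then have x: "\<And>f. f \<in> D \<Longrightarrow> sgn (f (($) x)) = \<tau> f" by blast
    have pos: "\<forall>f\<in>D1. 0 < \<tau> f * f (($) x)"
    proof
      fix f assume "f \<in> D1"
      then have f: "sgn (f (($) x)) = \<tau> f" "\<tau> f \<noteq> 0" using x by (auto simp: D1_def)
      then have "\<tau> f * f (($) x) = \<bar>f (($) x)\<bar>" by (metis abs_sgn mult.commute)
      then show "0 < \<tau> f * f (($) x)" using f by auto
    qed
    have "f0 (($) x) = 0"
      unfolding f0_def
    proof (intro sum.neutral ballI)
      fix f assume "f \<in> D - D1"
      then have "sgn (f (($) x)) = 0" using x[of f] by (simp add: D1_def)
      then show "(f (($) x))\<^sup>2 = 0" by (simp add: sgn_zero_iff)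
    qed
    then show "x \<in> basic_open_set gs" using pos gpos[OF pos] by (simp add: open_eq h_def)
  qed
  moreover have "basic_open_set gs \<subseteq> U"
  proof (rule subsetI, rule ccontr)
    fix x assume x: "x \<in> basic_open_set gs" "x \<notin> U"
    then have "x \<in> F" by (auto simp: open_eq F_def less_imp_le)
    then show False using RM gpos[of x] x(1) by (force simp: open_eq h_def norm_vec_power2)
  qed
  ultimately show ?thesis by blast
qed

lemma open_semialgebraic_finite_union:
  fixes U :: "(real^'n) set"
  assumes U: "open U" "semialgebraic_set U"
  shows "\<exists>gss. (\<forall>gs\<in>set gss. \<forall>g\<in>set gs. real_polynomial_function g) \<and>
    U = (\<Union>gs\<in>set gss. basic_open_set gs)"
proof -
  obtain D where D: "finite D" "\<forall>f\<in>D. polyfun f"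
    and det: "\<And>y y'. sign_agree D y y' \<Longrightarrow> ((\<chi> i. y i) \<in> U) = ((\<chi> i. y' i) \<in> U)"
    using U(2) unfolding semialgebraic_set_def semialgebraic_def by blast
  \<comment> \<open>Restricting to \<open>D\<close> fixes the values elsewhere, so all sign vectors
    lie in one finite function space.\<close>
  define \<tau> where "\<tau> x = restrict (\<lambda>f. sgn (f (($) x))) D" for x :: "real^'n"
  define C where "C t = {x::real^'n. \<forall>f\<in>D. sgn (f (($) x)) = t f}" for t :: "(('n \<Rightarrow> real) \<Rightarrow> real) \<Rightarrow> real"
  have T: "\<tau> ` U \<subseteq> D \<rightarrow>\<^sub>E {-1, 0, 1}" by (auto simp: \<tau>_def sgn_real_def split: if_splits)
  have "finite (\<tau> ` U)"
    using finite_subset[OF T finite_PiE] D(1) by blast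
  then obtain ts where ts: "set ts = \<tau> ` U" using finite_list by blast
  have "\<forall>t\<in>\<tau> ` U. \<exists>gs. (\<forall>g\<in>set gs. real_polynomial_function g) \<and>
      C t \<subseteq> basic_open_set gs \<and> basic_open_set gs \<subseteq> U"
  proof
    fix t assume t: "t \<in> \<tau> ` U"
    then obtain x0 where x0: "x0 \<in> U" "t = \<tau> x0" by blast
    have "C t \<subseteq> U"
    proof
      fix x assume "x \<in> C t"
      then have "sign_agree D (($) x0) (($) x)" by (simp add: C_def x0(2) \<tau>_def sign_agree_def)
      then show "x \<in> U" using det x0(1) by fastforce
    qed
    moreover have "\<forall>f\<in>D. t f \<in> {-1, 0, 1}" using T t by (auto simp: PiE_iff)
    ultimately show "\<exists>gs. (\<forall>g\<in>set gs. real_polynomial_function g) \<and>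
      C t \<subseteq> basic_open_set gs \<and> basic_open_set gs \<subseteq> U"
      unfolding C_def by (intro sign_class_in_basic_open[OF U D])
  qed
  from bchoice[OF this] obtain G where G:
    "\<forall>t\<in>\<tau> ` U. (\<forall>g\<in>set (G t). real_polynomial_function g) \<and> C t \<subseteq> basic_open_set (G t) \<and> basic_open_set (G t) \<subseteq> U"
    by blast
  have "x \<in> C (\<tau> x)" for x by (simp add: C_def \<tau>_def)
  then have "U = (\<Union>gs\<in>set (map G ts). basic_open_set gs)"
    using G by (auto simp: ts)
  moreover have "\<forall>gs\<in>set (map G ts). \<forall>g\<in>set gs. real_polynomial_function g"
    using G by (auto simp: ts)
  ultimately show ?thesis by blast
qed

text \<open>The complement is a union of basic open sets. By De Morgan, the set is an intersection
  of finite unions of weak inequalities, which is distributed into a union of intersections.\<close>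

lemma closed_semialgebraic_finite_union:
  fixes C :: "(real^'n) set"
  assumes "closed C" "semialgebraic_set C"
  shows "\<exists>gss. (\<forall>gs\<in>set gss. \<forall>g\<in>set gs. real_polynomial_function g) \<and>
    C = (\<Union>gs\<in>set gss. basic_closed_set gs)"
proof -
  obtain gss :: "(real^'n \<Rightarrow> real) list list" where
    gss: "\<forall>gs\<in>set gss. \<forall>g\<in>set gs. real_polynomial_function g"
    and "- C = (\<Union>gs\<in>set gss. basic_open_set gs)"
    using open_semialgebraic_finite_union[OF open_Compl[OF assms(1)] semialgebraic_set_compl[OF assms(2)]]
    by blast
  then have "C = (\<Inter>gs\<in>set gss. - basic_open_set gs)" by blast
  moreover have "\<exists>hss. (\<forall>hs\<in>set hss. \<forall>h\<in>set hs. real_polynomial_function h) \<and>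
    (\<Inter>gs\<in>set gss. - basic_open_set gs) = (\<Union>hs\<in>set hss. basic_closed_set hs)"
    using gss
  proof (induction gss)
    case Nil
    \<comment> \<open>The empty intersection is the whole space, described by a single empty
      system.\<close>
    then show ?case by (intro exI[of _ "[[]]"]) (simp add: basic_closed_set_eq)
  next
    case (Cons gs gss)
    then obtain hss where hss: "\<forall>hs\<in>set hss. \<forall>h\<in>set hs. real_polynomial_function h"
      "(\<Inter>gs\<in>set gss. - basic_open_set gs) = (\<Union>hs\<in>set hss. basic_closed_set hs)" by auto
    \<comment> \<open>Each new system combines one negated member of \<open>gs\<close> with one
      earlier system.\<close>
    let ?kss = "concat (map (\<lambda>g. map ((#) (\<lambda>x. - g x)) hss) gs)"
    have "- basic_open_set gs = (\<Union>g\<in>set gs. {x. 0 \<le> - g x})"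
      by (auto simp: basic_open_set_eq not_less)
    then have "(\<Inter>gs\<in>set (gs # gss). - basic_open_set gs) = (\<Union>hs\<in>set ?kss. basic_closed_set hs)"
      using hss(2) by (simp add: basic_closed_set_eq) blast
    moreover have "\<forall>hs\<in>set ?kss. \<forall>h\<in>set hs. real_polynomial_function h"
      using Cons.prems hss(1) by (auto intro: real_polynomial_function_minus)
    ultimately show ?case by blast
  qed
  ultimately show ?thesis by simp
qed

section \<open>Quasi-concavity\<close>

text \<open>The partial derivatives come out as polynomials again. So \<open>deriv\<close> in
  \<open>partial_deriv\<close> is a genuine derivative and the argument can be repeated for the
  Hessian.\<close>

lemma real_polynomial_has_derivative:
  fixes f :: "real^'n \<Rightarrow> real"
  assumes "real_polynomial_function f"
  shows "\<exists>G. (\<forall>i. real_polynomial_function (G i)) \<and>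
    (\<forall>x. (f has_derivative (\<lambda>h. \<Sum>i\<in>UNIV. G i x * h $ i)) (at x))"
  using assms
proof (induction rule: real_polynomial_function.induct)
  case (linear f)
  have "f h = (\<Sum>i\<in>UNIV. f (axis i 1) * h $ i)" for h
  proof -
    have "f h = f (\<Sum>i\<in>UNIV. h $ i *\<^sub>R axis i 1)"
      by (metis basis_expansion scalar_mult_eq_scaleR)
    then show ?thesis
      using linear by (simp add: bounded_linear.linear linear_sum linear_scale mult.commute)
  qed
  then have "f = (\<lambda>h. \<Sum>i\<in>UNIV. f (axis i 1) * h $ i)" by blast
  then have "(f has_derivative (\<lambda>h. \<Sum>i\<in>UNIV. f (axis i 1) * h $ i)) (at x)" for x
    using bounded_linear_imp_has_derivative[OF linear] by metis
  then show ?case by (intro exI[of _ "\<lambda>i _. f (axis i 1)"]) auto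
next
  case (const c)
  show ?case by (intro exI[of _ "\<lambda>_ _. 0"]) auto
next
  case (add f g)
  obtain F where F: "\<And>i. real_polynomial_function (F i)"
    "\<And>x. (f has_derivative (\<lambda>h. \<Sum>i\<in>UNIV. F i x * h $ i)) (at x)" using add.IH(1) by blast
  obtain G where G: "\<And>i. real_polynomial_function (G i)"
    "\<And>x. (g has_derivative (\<lambda>h. \<Sum>i\<in>UNIV. G i x * h $ i)) (at x)" using add.IH(2) by blast
  show ?case
    using F(1) G(1) has_derivative_add[OF F(2) G(2)]
    by (intro exI[of _ "\<lambda>i x. F i x + G i x"]) (auto simp: sum.distrib algebra_simps)
next
  case (mult f g)
  obtain F where F: "\<And>i. real_polynomial_function (F i)"
    "\<And>x. (f has_derivative (\<lambda>h. \<Sum>i\<in>UNIV. F i x * h $ i)) (at x)" using mult.IH(1) by blast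
  obtain G where G: "\<And>i. real_polynomial_function (G i)"
    "\<And>x. (g has_derivative (\<lambda>h. \<Sum>i\<in>UNIV. G i x * h $ i)) (at x)" using mult.IH(2) by blast
  have "((\<lambda>x. f x * g x) has_derivative (\<lambda>h. \<Sum>i\<in>UNIV. (f x * G i x + F i x * g x) * h $ i)) (at x)" for x
    by (rule has_derivative_eq_rhs[OF has_derivative_mult[OF F(2) G(2)]])
      (auto simp: fun_eq_iff sum_distrib_left sum_distrib_right sum.distrib algebra_simps)
  moreover have "real_polynomial_function (\<lambda>x. f x * G i x + F i x * g x)" for i
    by (intro real_polynomial_function.intros(3,4) F(1) G(1) mult.hyps)
  ultimately show ?case
    by (intro exI[of _ "\<lambda>i x. f x * G i x + F i x * g x"]) blast
qed

lemma has_real_derivative_along: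
  fixes f :: "real^'n \<Rightarrow> real"
  assumes "(f has_derivative f') (at (\<gamma> t))" "(\<gamma> has_vector_derivative v) (at t)"
  shows "((\<lambda>t. f (\<gamma> t)) has_real_derivative f' v) (at t)"
  using vector_derivative_diff_chain_within[of \<gamma> v t UNIV f f'] assms
  by (simp add: has_real_derivative_iff_has_vector_derivative o_def has_derivative_at_withinI)

lemma partial_deriv_eq:
  fixes f :: "real^'n \<Rightarrow> real"
  assumes "(f has_derivative (\<lambda>h. \<Sum>i\<in>UNIV. G i * h $ i)) (at x)"
  shows "partial_deriv i f x = G i"
proof -
  have "((\<lambda>t. x + t *\<^sub>R axis i 1) has_vector_derivative axis i 1) (at 0)"
    by (auto intro!: derivative_eq_intros)
  then have "((\<lambda>t. f (x + t *\<^sub>R axis i 1)) has_real_derivative (\<Sum>j\<in>UNIV. G j * axis i 1 $ j)) (at 0)"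
    using assms by (intro has_real_derivative_along) auto
  moreover have "(\<Sum>j\<in>UNIV. G j * axis i 1 $ j) = G i" by (simp add: axis_def if_distrib cong: if_cong)
  ultimately show ?thesis unfolding partial_deriv_def by (simp add: DERIV_imp_deriv)
qed

lemma real_polynomial_partial_deriv:
  "real_polynomial_function f \<Longrightarrow> real_polynomial_function (partial_deriv i f)" for f :: "real^'n \<Rightarrow> real"
proof -
  assume "real_polynomial_function f"
  then obtain G where G: "\<And>i. real_polynomial_function (G i)"
    "\<And>x. (f has_derivative (\<lambda>h. \<Sum>i\<in>UNIV. G i x * h $ i)) (at x)"
    using real_polynomial_has_derivative by blast
  have "partial_deriv i f = G i" by (rule ext) (rule partial_deriv_eq[OF G(2)])
  then show ?thesis using G(1) by simp
qed

lemma gradient_along: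
  fixes f :: "real^'n \<Rightarrow> real"
  assumes "real_polynomial_function f" "(\<gamma> has_vector_derivative v) (at t)"
  shows "((\<lambda>t. f (\<gamma> t)) has_real_derivative gradient f (\<gamma> t) \<bullet> v) (at t)"
proof -
  obtain G where G: "\<And>x. (f has_derivative (\<lambda>h. \<Sum>i\<in>UNIV. G i x * h $ i)) (at x)"
    using real_polynomial_has_derivative[OF assms(1)] by blast
  have "gradient f (\<gamma> t) \<bullet> v = (\<Sum>i\<in>UNIV. G i (\<gamma> t) * v $ i)"
    by (simp add: gradient_def inner_vec_def partial_deriv_eq[OF G])
  then show ?thesis using has_real_derivative_along[OF G assms(2)] by simp
qed

text \<open>This grouping arises when the partial derivatives are differentiated along a curve, and
  it shows the form to be even in \<open>v\<close>.\<close>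

lemma hessian_form:
  fixes f :: "real^'n \<Rightarrow> real"
  shows "v \<bullet> (hessian f x *v v) = (\<Sum>j\<in>UNIV. (gradient (partial_deriv j f) x \<bullet> v) * v $ j)"
proof -
  have "v \<bullet> (hessian f x *v v) =
    (\<Sum>i\<in>UNIV. \<Sum>j\<in>UNIV. v $ i * (partial_deriv i (partial_deriv j f) x * v $ j))"
    by (simp add: inner_vec_def matrix_vector_mult_def hessian_def sum_distrib_left)
  also have "\<dots> = (\<Sum>j\<in>UNIV. \<Sum>i\<in>UNIV. v $ i * (partial_deriv i (partial_deriv j f) x * v $ j))"
    by (rule sum.swap)
  finally show ?thesis
    by (simp add: inner_vec_def gradient_def sum_distrib_left sum_distrib_right algebra_simps)
qed

section \<open>Second-order conditions at boundary points\<close>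

lemma positive_along_ray:
  fixes f :: "real^'n \<Rightarrow> real"
  assumes f: "real_polynomial_function f" "f w = 0" and d: "0 < gradient f w \<bullet> d"
  shows "\<forall>\<^sub>F t in at_right 0. 0 < f (w + t *\<^sub>R d)"
proof -
  have "((\<lambda>t. w + t *\<^sub>R d) has_vector_derivative d) (at 0)"
    by (auto intro!: derivative_eq_intros)
  from gradient_along[OF f(1) this]
  have "((\<lambda>t. f (w + t *\<^sub>R d)) has_real_derivative gradient f w \<bullet> d) (at 0)" by simp
  from DERIV_pos_inc_right[OF this d] obtain e where "e > 0" "\<And>h. 0 < h \<Longrightarrow> h < e \<Longrightarrow> 0 < f (w + h *\<^sub>R d)"
    using f(2) by auto
  then show ?thesis unfolding eventually_at_right_field by blast
qed

text \<open>Along the parabola \<open>f\<close> has value and first derivative zero at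
  \<open>t = 0\<close>, and \<open>pos\<close> says that its second derivative there is positive. So
  the first derivative \<open>k\<close> is positive just to the right of 0, and by the mean value
  theorem so is \<open>f\<close>.\<close>

lemma positive_along_parabola:
  fixes f :: "real^'n \<Rightarrow> real"
  assumes f: "real_polynomial_function f" "f w = 0" and v: "gradient f w \<bullet> v = 0"
    and pos: "0 < v \<bullet> (hessian f w *v v) + 2 * s * (gradient f w \<bullet> gradient f w)"
  shows "\<forall>\<^sub>F t in at_right 0. 0 < f (w + t *\<^sub>R v + (s * t\<^sup>2) *\<^sub>R gradient f w)"
proof -
  define n where "n = gradient f w"
  define \<gamma> where "\<gamma> t = w + t *\<^sub>R v + (s * t\<^sup>2) *\<^sub>R n" for t
  define k where "k t = gradient f (\<gamma> t) \<bullet> (v + (2 * s * t) *\<^sub>R n)" for t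
  have \<gamma>: "(\<gamma> has_vector_derivative v + (2 * s * t) *\<^sub>R n) (at t)" for t
    unfolding \<gamma>_def by (auto intro!: derivative_eq_intros simp: algebra_simps)
  have df: "((\<lambda>t. f (\<gamma> t)) has_real_derivative k t) (at t)" for t
    unfolding k_def by (rule gradient_along[OF f(1) \<gamma>])
  have k_eq: "k t = (\<Sum>j\<in>UNIV. partial_deriv j f (\<gamma> t) * (v $ j + 2 * s * t * n $ j))" for t
    by (simp add: k_def inner_vec_def gradient_def)
  have "(k has_real_derivative
      (\<Sum>j\<in>UNIV. (gradient (partial_deriv j f) w \<bullet> v) * v $ j + partial_deriv j f w * (2 * s * n $ j))) (at 0)"
    unfolding k_eq
  proof (rule DERIV_sum)
    fix j
    have "((\<lambda>t. partial_deriv j f (\<gamma> t)) has_real_derivative gradient (partial_deriv j f) w \<bullet> v) (at 0)"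
      using gradient_along[OF real_polynomial_partial_deriv[OF f(1)] \<gamma>, of j 0] by (simp add: \<gamma>_def)
    then show "((\<lambda>t. partial_deriv j f (\<gamma> t) * (v $ j + 2 * s * t * n $ j)) has_real_derivative
      (gradient (partial_deriv j f) w \<bullet> v) * v $ j + partial_deriv j f w * (2 * s * n $ j)) (at 0)"
      by (auto intro!: derivative_eq_intros simp: \<gamma>_def)
  qed
  moreover have "(\<Sum>j\<in>UNIV. (gradient (partial_deriv j f) w \<bullet> v) * v $ j + partial_deriv j f w * (2 * s * n $ j))
      = v \<bullet> (hessian f w *v v) + 2 * s * (n \<bullet> n)"
    unfolding hessian_form sum.distrib
    by (simp add: n_def gradient_def inner_vec_def sum_distrib_left algebra_simps)
  ultimately have dk: "(k has_real_derivative v \<bullet> (hessian f w *v v) + 2 * s * (n \<bullet> n)) (at 0)" by simp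
  have "k 0 = 0" using v by (simp add: k_def \<gamma>_def)
  then obtain e where e: "e > 0" "\<And>h. 0 < h \<Longrightarrow> h < e \<Longrightarrow> 0 < k h"
    using DERIV_pos_inc_right[OF dk] pos by (auto simp: n_def)
  have "0 < f (\<gamma> t)" if t: "0 < t" "t < e" for t
  proof -
    obtain z where "0 < z" "z < t" "f (\<gamma> t) - f (\<gamma> 0) = (t - 0) * k z"
      using MVT2[of 0 t "\<lambda>t. f (\<gamma> t)" k] df t(1) by blast
    then show ?thesis using e(2)[of z] t f(2) by (simp add: \<gamma>_def)
  qed
  then show ?thesis unfolding eventually_at_right_field \<gamma>_def n_def using e(1) by blast
qed

text \<open>Suppose the form is positive at \<open>v\<close>. Then two parabolas leaving
  \<open>w\<close> in the directions \<open>v\<close> and \<open>- v\<close>, both bent against the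
  gradient, still run inside \<open>C\<close>. In the sum of their supporting hyperplane
  inequalities the linear terms cancel, and the bending term has the wrong sign.\<close>

lemma hessian_nonpos_at_supported_point:
  fixes f :: "real^'n \<Rightarrow> real"
  assumes f: "real_polynomial_function f" "f w = 0" "gradient f w \<noteq> 0"
    and C: "convex C" "closed C" "w \<in> frontier C"
    and V: "open V" "w \<in> V" "\<And>x. x \<in> V \<Longrightarrow> 0 \<le> f x \<Longrightarrow> x \<in> C"
    and v: "gradient f w \<bullet> v = 0"
  shows "v \<bullet> (hessian f w *v v) \<le> 0"
proof (rule ccontr)
  assume "\<not> ?thesis"
  then have q: "0 < v \<bullet> (hessian f w *v v)" by simp
  let ?n = "gradient f w"
  have nn: "0 < ?n \<bullet> ?n" using f(3) by simp
  have inV: "\<forall>\<^sub>F t in at_right 0. w + t *\<^sub>R d + (s * t\<^sup>2) *\<^sub>R z \<in> V" for d z and s :: real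
  proof -
    have "((\<lambda>t. w + t *\<^sub>R d + (s * t\<^sup>2) *\<^sub>R z) \<longlongrightarrow> w + 0 *\<^sub>R d + (s * 0\<^sup>2) *\<^sub>R z) (at_right 0)"
      by (intro tendsto_intros)
    then show ?thesis using V(1,2) by (simp add: topological_tendstoD)
  qed
  \<comment> \<open>With nonempty interior the relative interior is the interior, so the frontier
    point \<open>w\<close> is a relative frontier point and a supporting hyperplane exists.\<close>
  have "interior C \<noteq> {}"
  proof -
    have "\<forall>\<^sub>F t in at_right 0. 0 < f (w + t *\<^sub>R ?n) \<and> w + t *\<^sub>R ?n \<in> V"
      using positive_along_ray[OF f(1,2) nn] inV[of ?n 0 0] by (simp add: eventually_conj_iff)
    then obtain t where t: "0 < f (w + t *\<^sub>R ?n)" "w + t *\<^sub>R ?n \<in> V"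
      using eventually_happens'[OF trivial_limit_at_right_real] by blast
    have "continuous_on UNIV f"
      by (intro continuous_at_imp_continuous_on ballI continuous_real_polymonial_function f(1))
    then have "open (V \<inter> {x. 0 < f x})"
      using V(1) by (intro open_Int open_Collect_less continuous_intros) auto
    moreover have "V \<inter> {x. 0 < f x} \<subseteq> C" using V(3) by auto
    ultimately have "V \<inter> {x. 0 < f x} \<subseteq> interior C" by (rule interior_maximal[rotated])
    then show ?thesis using t by blast
  qed
  then have "w \<notin> rel_interior C"
    using C(3) by (simp add: rel_interior_nonempty_interior frontier_def)
  moreover have "w \<in> closure C" using C(3) by (simp add: frontier_def)
  ultimately obtain a where a: "a \<noteq> 0" "\<And>y. y \<in> C \<Longrightarrow> a \<bullet> w \<le> a \<bullet> y"
    using supporting_hyperplane_relative_frontier[OF C(1)] closure_closed[OF C(2)] by metis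
  \<comment> \<open>A curve that enters \<open>f > 0\<close> stays in \<open>C\<close> for small
    \<open>t\<close>, so its displacement from \<open>w\<close> lies on the supporting side.\<close>
  have cone: "\<forall>\<^sub>F t in at_right 0. 0 < t \<and> 0 \<le> t * (a \<bullet> d) + s * t\<^sup>2 * (a \<bullet> z)"
    if "\<forall>\<^sub>F t in at_right 0. 0 < f (w + t *\<^sub>R d + (s * t\<^sup>2) *\<^sub>R z)" for d z s
    using that inV[of d s z] eventually_at_right_less[of 0]
  proof eventually_elim
    case (elim t)
    then show ?case using a(2)[of "w + t *\<^sub>R d + (s * t\<^sup>2) *\<^sub>R z"] V(3) by (auto simp: inner_add_right less_imp_le)
  qed
  have an: "0 < a \<bullet> ?n"
  proof -
    \<comment> \<open>This \<open>e\<close> is so small that tilting the gradient by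
      \<open>e *\<^sub>R a\<close> leaves an ascent direction. The supporting inequality for the
      tilted direction upgrades \<open>a \<bullet> ?n\<close> from nonnegative to positive.\<close>
    define e where "e = (?n \<bullet> ?n) / (2 * (\<bar>?n \<bullet> a\<bar> + 1))"
    have e: "0 < e" unfolding e_def using nn by (intro divide_pos_pos) auto
    have "e * (?n \<bullet> a) \<le> e * (\<bar>?n \<bullet> a\<bar> + 1)" using e by (intro mult_left_mono) auto
    also have "\<dots> = (?n \<bullet> ?n) / 2"
      by (simp add: e_def field_simps add_nonneg_eq_0_iff)
    finally have "e * (?n \<bullet> a) < ?n \<bullet> ?n" using nn by linarith
    then have "0 < ?n \<bullet> (?n - e *\<^sub>R a)" by (simp add: inner_diff_right)
    from positive_along_ray[OF f(1,2) this]
    have "\<forall>\<^sub>F t in at_right 0. 0 < t \<and> 0 \<le> t * (a \<bullet> (?n - e *\<^sub>R a))"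
      using cone[of "?n - e *\<^sub>R a" 0 0] by simp
    then obtain t where "0 < t" "0 \<le> t * (a \<bullet> (?n - e *\<^sub>R a))"
      using eventually_happens'[OF trivial_limit_at_right_real] by blast
    then have "0 \<le> a \<bullet> (?n - e *\<^sub>R a)" by (simp add: zero_le_mult_iff)
    then have "e * (a \<bullet> a) \<le> a \<bullet> ?n" by (simp add: inner_diff_right)
    then show ?thesis using e a(1) by (metis inner_gt_zero_iff less_le_trans mult_pos_pos)
  qed
  \<comment> \<open>The bending uses up half of the form at \<open>v\<close>, leaving a positive
    second derivative along the parabola.\<close>
  define s where "s = - (v \<bullet> (hessian f w *v v)) / (4 * (?n \<bullet> ?n))"
  have s: "s < 0" using q nn by (simp add: s_def divide_neg_pos)
  have "2 * s * (?n \<bullet> ?n) = - (v \<bullet> (hessian f w *v v)) / 2" using f(3) by (simp add: s_def)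
  then have pos: "0 < v \<bullet> (hessian f w *v v) + 2 * s * (?n \<bullet> ?n)" using q by simp
  have neg: "(- v) \<bullet> (hessian f w *v (- v)) = v \<bullet> (hessian f w *v v)"
    unfolding hessian_form by simp
  have "\<forall>\<^sub>F t in at_right 0. (0 < t \<and> 0 \<le> t * (a \<bullet> v) + s * t\<^sup>2 * (a \<bullet> ?n)) \<and>
      (0 < t \<and> 0 \<le> t * (a \<bullet> - v) + s * t\<^sup>2 * (a \<bullet> ?n))"
  proof (rule eventually_conj)
    show "\<forall>\<^sub>F t in at_right 0. 0 < t \<and> 0 \<le> t * (a \<bullet> v) + s * t\<^sup>2 * (a \<bullet> ?n)"
      by (rule cone[OF positive_along_parabola[OF f(1,2) v pos]])
    show "\<forall>\<^sub>F t in at_right 0. 0 < t \<and> 0 \<le> t * (a \<bullet> - v) + s * t\<^sup>2 * (a \<bullet> ?n)"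
      by (rule cone[OF positive_along_parabola[OF f(1,2)]]) (simp add: v, unfold neg, rule pos)
  qed
  then obtain t where t: "0 < t" "0 \<le> t * (a \<bullet> v) + s * t\<^sup>2 * (a \<bullet> ?n)"
      "0 \<le> t * (a \<bullet> - v) + s * t\<^sup>2 * (a \<bullet> ?n)"
    using eventually_happens'[OF trivial_limit_at_right_real] by blast
  then have "0 \<le> s * t\<^sup>2 * (a \<bullet> ?n)" by simp
  moreover have "s * t\<^sup>2 * (a \<bullet> ?n) < 0" using s t(1) an by (simp add: mult_neg_pos)
  ultimately show False by simp
qed

text \<open>Only constraint \<open>i\<close> is active, and all others are strictly positive on an
  open neighbourhood \<open>V\<close> of \<open>w\<close>. Within \<open>V\<close> the condition
  \<open>gs ! i \<ge> 0\<close> alone implies membership in \<open>C\<close>.\<close>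

lemma hessian_nonpos_at_nonsingular_boundary_point:
  fixes gs :: "(real^'n \<Rightarrow> real) list"
  assumes gs: "\<forall>g\<in>set gs. real_polynomial_function g"
    and C: "convex C" "closed C" "w \<in> frontier C" "basic_closed_set gs \<subseteq> C"
    and w: "nonsingular_boundary_point gs w" "i < length gs" "(gs ! i) w = 0"
    and v: "gradient (gs ! i) w \<bullet> v = 0"
  shows "gradient (gs ! i) w \<noteq> 0" "v \<bullet> (hessian (gs ! i) w *v v) \<le> 0"
proof -
  have cont: "continuous_on UNIV (gs ! j)" if "j < length gs" for j
    using gs that by (intro continuous_at_imp_continuous_on ballI continuous_real_polymonial_function) auto
  have "i \<in> active_indices gs w" using w(2,3) by (simp add: active_indices_def)
  then have act: "active_indices gs w = {i}"
    using w(1) unfolding nonsingular_boundary_point_def by (metis card_1_singletonE singletonD)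
  then show n: "gradient (gs ! i) w \<noteq> 0"
    using w(1) unfolding nonsingular_boundary_point_def by blast
  define V where "V = (\<Inter>j\<in>{..<length gs} - {i}. {x. 0 < (gs ! j) x})"
  have "open V"
    unfolding V_def by (intro open_INT ballI open_Collect_less cont continuous_intros) auto
  have "basic_closed_set gs = (\<Inter>j\<in>{..<length gs}. {x. 0 \<le> (gs ! j) x})"
    by (auto simp: basic_closed_set_def)
  then have "closed (basic_closed_set gs)"
    by (auto intro!: closed_INT closed_Collect_le cont)
  then have "w \<in> basic_closed_set gs"
    using w(1) by (auto simp: nonsingular_boundary_point_def frontier_def)
  have "0 < (gs ! j) w" if "j < length gs" "j \<noteq> i" for j
  proof -
    have "j \<notin> active_indices gs w" using act that(2) by simp
    then have "(gs ! j) w \<noteq> 0" using that(1) by (simp add: active_indices_def)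
    moreover have "0 \<le> (gs ! j) w"
      using \<open>w \<in> basic_closed_set gs\<close> that(1) by (simp add: basic_closed_set_def)
    ultimately show ?thesis by simp
  qed
  then have "w \<in> V" by (auto simp: V_def)
  have "x \<in> C" if "x \<in> V" "0 \<le> (gs ! i) x" for x
  proof -
    have "0 \<le> (gs ! j) x" if "j < length gs" for j
      using \<open>x \<in> V\<close> \<open>0 \<le> (gs ! i) x\<close> that by (cases "j = i") (auto simp: V_def less_imp_le)
    then show ?thesis using C(4) by (auto simp: basic_closed_set_def)
  qed
  then show "v \<bullet> (hessian (gs ! i) w *v v) \<le> 0"
    using hessian_nonpos_at_supported_point[OF _ w(3) n C(1-3) \<open>open V\<close> \<open>w \<in> V\<close> _ v] gs w(2) by simp
qed

text \<open>A vector tangent at \<open>u\<close> need not be tangent at the approximating points.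
  Its orthogonal projections to the tangent spaces there converge to it, as the gradient at
  \<open>u\<close> is nonzero, and the inequality passes to the limit.\<close>

lemma quasi_concave_at_limit:
  fixes f :: "real^'n \<Rightarrow> real"
  assumes f: "real_polynomial_function f" and u: "gradient f u \<noteq> 0" and lim: "w \<longlonglongrightarrow> u"
    and w: "\<And>N. gradient f (w N) \<noteq> 0"
      "\<And>N v. gradient f (w N) \<bullet> v = 0 \<Longrightarrow> v \<bullet> (hessian f (w N) *v v) \<le> 0"
  shows "quasi_concave_at f u"
  unfolding quasi_concave_at_def
proof (intro allI impI)
  fix v assume v: "gradient f u \<bullet> v = 0"
  have pol: "((\<lambda>N. g (w N)) \<longlongrightarrow> g u) sequentially" if "real_polynomial_function g" for g
    using continuous_real_polymonial_function[OF that, of u] lim by (metis isCont_tendsto_compose)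
  have grad: "(\<lambda>N. gradient g (w N)) \<longlonglongrightarrow> gradient g u" if "real_polynomial_function g" for g
    unfolding gradient_def
    by (intro tendsto_vec_lambda pol real_polynomial_partial_deriv that)
  define z where "z N = v - ((gradient f (w N) \<bullet> v) / (gradient f (w N) \<bullet> gradient f (w N))) *\<^sub>R gradient f (w N)" for N
  have "gradient f (w N) \<bullet> z N = 0" for N using w(1)[of N] by (simp add: z_def inner_diff_right)
  then have le: "z N \<bullet> (hessian f (w N) *v z N) \<le> 0" for N using w(2) by blast
  have "z \<longlonglongrightarrow> v - ((gradient f u \<bullet> v) / (gradient f u \<bullet> gradient f u)) *\<^sub>R gradient f u"
    unfolding z_def using u by (intro tendsto_intros grad f) simp
  then have z: "z \<longlonglongrightarrow> v" using v by simp
  have "(\<lambda>N. z N \<bullet> (hessian f (w N) *v z N)) \<longlonglongrightarrow> v \<bullet> (hessian f u *v v)"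
    unfolding hessian_form
    by (intro tendsto_intros grad real_polynomial_partial_deriv f z)
  then have "v \<bullet> (hessian f u *v v) \<le> 0"
    by (rule tendsto_upperbound) (use le in auto)
  then show "- (v \<bullet> (hessian f u *v v)) \<ge> 0" by simp
qed

theorem theorem3p5:
  fixes S :: "(real ^ 'n) set"
  assumes "convex S" and "SDP_representable S"
  shows
    "(\<exists>gss :: (real ^ 'n \<Rightarrow> real) list list.
        (\<forall>gs\<in>set gss. \<forall>g\<in>set gs. real_polynomial_function g) \<and>
        interior S = (\<Union>gs\<in>set gss. basic_open_set gs)) \<and>
     (\<exists>gss :: (real ^ 'n \<Rightarrow> real) list list.
        (\<forall>gs\<in>set gss. \<forall>g\<in>set gs. real_polynomial_function g) \<and>
        closure S = (\<Union>gs\<in>set gss. basic_closed_set gs)) \<and>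
     (\<forall>gss :: (real ^ 'n \<Rightarrow> real) list list.
        (\<forall>gs\<in>set gss. \<forall>g\<in>set gs. real_polynomial_function g) \<longrightarrow>
        closure S = (\<Union>gs\<in>set gss. basic_closed_set gs) \<longrightarrow>
        (\<forall>gs\<in>set gss. \<forall>u\<in>frontier (closure S) \<inter> frontier (basic_closed_set gs).
           \<forall>i\<in>active_indices gs u.
             irredundant_at gs i (frontier (closure S)) u \<longrightarrow>
             nonsingular_at (gs ! i) u \<longrightarrow>
             quasi_concave_at (gs ! i) u))"
proof -
  have S: "semialgebraic_set S" using SDP_representable_semialgebraic[OF assms(2)] .
  \<comment> \<open>The interior is the complement of the closure of the complement.\<close>
  have "semialgebraic_set (interior S)"
    using semialgebraic_set_compl[OF semialgebraic_set_closure[OF semialgebraic_set_compl[OF S]]]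
    by (simp add: interior_closure)
  note open_part = open_semialgebraic_finite_union[OF open_interior this]
  note closed_part = closed_semialgebraic_finite_union[OF closed_closure semialgebraic_set_closure[OF S]]
  have quasi: "quasi_concave_at (gs ! i) u"
    if polys: "\<forall>gs\<in>set gss. \<forall>g\<in>set gs. real_polynomial_function g"
      and clS: "closure S = (\<Union>gs\<in>set gss. basic_closed_set gs)"
      and gs: "gs \<in> set gss" and i: "i \<in> active_indices gs u"
      and irr: "irredundant_at gs i (frontier (closure S)) u"
      and ns: "nonsingular_at (gs ! i) u" for gss gs u i
  proof -
    have len: "i < length gs" using i by (simp add: active_indices_def)
    have pgs: "\<forall>g\<in>set gs. real_polynomial_function g" using polys gs by blast
    have sub: "basic_closed_set gs \<subseteq> closure S" using clS gs by blast
    obtain w where w: "\<And>N. nonsingular_boundary_point gs (w N)" "\<And>N. (gs ! i) (w N) = 0"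
      "\<And>N. w N \<in> frontier (closure S)" and lim: "w \<longlonglongrightarrow> u"
      using irr unfolding irredundant_at_def by blast
    note point = hessian_nonpos_at_nonsingular_boundary_point[OF pgs convex_closure[OF assms(1)]
        closed_closure w(3) sub w(1) len w(2)]
    \<comment> \<open>The zero vector is tangent everywhere, so it serves to extract the
      nonvanishing of the gradient from \<open>point\<close>.\<close>
    have g: "real_polynomial_function (gs ! i)" "gradient (gs ! i) u \<noteq> 0"
      "gradient (gs ! i) (w N) \<noteq> 0" for N
      using pgs len ns point(1)[of N 0] by (simp_all add: nonsingular_at_def)
    show ?thesis by (rule quasi_concave_at_limit[OF g(1,2) lim g(3) point(2)])
  qed
  show ?thesis
    by (intro conjI open_part closed_part allI ballI impI, elim IntE) (rule quasi)
qed

end
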